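(* Let $\Omega\subset\mathbb{R}^n$ be a convex domain. Let $\phi(\varepsilon)$, $\varepsilon>0$, be a positive function such that $$\lim_{\varepsilon\to0}\phi(\varepsilon)=\infty\qquad\text{and}\qquad \lim_{\varepsilon\to0}\varepsilon\,\phi(\varepsilon)=0.$$ Let $u:\Omega\to\mathbb{R}$ be convex and of class $C^2$ in $\Omega$. Then, for every $x\in\Omega$, $$u(x)=\inf_{\substack{\det A=1\\ A\le\phi(\varepsilon)I}}\left\{\frac{1}{|B_\varepsilon(0)|}\int_{B_\varepsilon(0)}u(x+Ay)\,dy\right\}-\frac{n}{2(n+2)}\left(\det D^2u(x)\right)^{1/n}\varepsilon^2+o(\varepsilon^2)\qquad\text{as }\varepsilon\to0,$$ where the infimum is over symmetric positive definite $n\times n$ real matrices $A$ satisfying the stated constraints.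
   Context: $B_\varepsilon(0)=\{y\in\mathbb{R}^n:|y|\le\varepsilon\}$ and $|B_\varepsilon(0)|$ is its Lebesgue measure. $I$ is the identity matrix; for symmetric matrices $A\le\phi(\varepsilon)I$ means that $\phi(\varepsilon)I-A$ is positive semidefinite. For $x\in\Omega$ and $\varepsilon$ small enough (depending on $x$), $A\le\phi(\varepsilon)I$ and $|y|\le\varepsilon$ imply $|Ay|\le\varepsilon\phi(\varepsilon)<\mathrm{dist}(x,\partial\Omega)$, so the integrals make sense; the expansion is understood for such $\varepsilon$, pointwise in $x$ (no uniformity in $x$ is claimed). *)

theory Defs
  imports "HOL-Analysis.Analysis" "HOL-Library.Landau_Symbols"
begin

definition gradient :: "(real ^ 'n \<Rightarrow> real) \<Rightarrow> real ^ 'n \<Rightarrow> real ^ 'n" where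
  "gradient u x = (\<chi> i. frechet_derivative u (at x) (axis i 1))"

text \<open>The entry in row \<open>i\<close> and column \<open>j\<close> is the \<open>j\<close>-th partial derivative of the \<open>i\<close>-th partial
  derivative. It is meaningful where \<open>u\<close> is differentiable near \<open>x\<close> and its gradient is
  differentiable at \<open>x\<close>.\<close>

definition hessian :: "(real ^ 'n::finite \<Rightarrow> real) \<Rightarrow> real ^ 'n \<Rightarrow> real ^ 'n ^ 'n" where
  "hessian u x = jacobian (gradient u) (at x)"

text \<open>Intended for open \<open>S\<close>, since the derivatives are full ones, not relative to \<open>S\<close>. Continuity of
  \<open>u\<close> and of its gradient follows from their differentiability.\<close>

definition C2_on :: "(real ^ 'n::finite) set \<Rightarrow> (real ^ 'n \<Rightarrow> real) \<Rightarrow> bool" where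
  "C2_on S u \<longleftrightarrow>
     (\<forall>x\<in>S. u differentiable (at x)) \<and>
     (\<forall>x\<in>S. gradient u differentiable (at x)) \<and>
     continuous_on S (hessian u)"

definition symmetric_matrix :: "real ^ 'n ^ 'n \<Rightarrow> bool" where
  "symmetric_matrix A \<longleftrightarrow> transpose A = A"

definition positive_definite :: "real ^ 'n::finite ^ 'n \<Rightarrow> bool" where
  "positive_definite A \<longleftrightarrow> symmetric_matrix A \<and> (\<forall>v. v \<noteq> 0 \<longrightarrow> 0 < v \<bullet> (A *v v))"

definition positive_semidefinite :: "real ^ 'n::finite ^ 'n \<Rightarrow> bool" where
  "positive_semidefinite A \<longleftrightarrow> symmetric_matrix A \<and> (\<forall>v. 0 \<le> v \<bullet> (A *v v))"

definition loewner_le :: "real ^ 'n::finite ^ 'n \<Rightarrow> real ^ 'n ^ 'n \<Rightarrow> bool" where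
  "loewner_le A B \<longleftrightarrow> positive_semidefinite (B - A)"

definition admissible_matrices :: "real \<Rightarrow> (real ^ 'n::finite ^ 'n) set" where
  "admissible_matrices c =
     {A. positive_definite A \<and> det A = 1 \<and> loewner_le A (c *\<^sub>R mat 1)}"

definition ball_average ::
    "(real ^ 'n::finite \<Rightarrow> real) \<Rightarrow> real ^ 'n \<Rightarrow> real ^ 'n ^ 'n \<Rightarrow> real \<Rightarrow> real" where
  "ball_average u x A \<epsilon> =
     1 / measure lebesgue (cball (0 :: real ^ 'n) \<epsilon>) *
       (LINT y:cball 0 \<epsilon>|lebesgue. u (x + A *v y))"

end

theory Submission
  imports Defs
begin

text \<open>
  The mean of \<open>y \<bullet> My\<close> over \<open>B\<^sub>\<epsilon>\<close> is \<open>\<epsilon>\<^sup>2 / (n + 2) tr M\<close> and linear terms have mean zero, so to second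
  order the mean of \<open>u (x + Ay)\<close> is \<open>u x + \<epsilon>\<^sup>2 / (2 (n + 2)) tr (A\<^sup>T H A)\<close> with \<open>H = D\<^sup>2 u(x) \<ge> 0\<close>.
  By the spectral theorem and the AM-GM inequality, \<open>tr (A\<^sup>T H A) \<ge> n (det H)\<^sup>1\<^sup>/\<^sup>n\<close> when
  \<open>det A = 1\<close>, and this infimum is approached by a matrix commuting with \<open>H\<close>.
  For the upper bound such a near-optimal matrix is kept fixed: it is admissible for small \<open>\<epsilon>\<close> because
  \<open>\<phi> \<rightarrow> \<infinity>\<close>, and the Taylor error is \<open>o(\<epsilon>\<^sup>2)\<close>.
  For the lower bound \<open>A\<close> varies with \<open>\<epsilon>\<close> and \<open>|Ay|\<close> is only \<open>O(\<epsilon> \<phi>(\<epsilon>)) = o(1)\<close>. If \<open>H\<close> is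
  invertible, the Taylor error \<open>o(|Ay|\<^sup>2)\<close> is absorbed into a small multiple of \<open>Ay \<bullet> H Ay\<close>; if \<open>H\<close> is
  singular, the claimed term vanishes and the midpoint inequality suffices.
\<close>

section \<open>Symmetric matrices\<close>

lemma symmetric_matrix_inner:
  fixes M :: "real^'n^'n"
  assumes "symmetric_matrix M"
  shows "v \<bullet> (M *v w) = (M *v v) \<bullet> w"
  using assms by (metis dot_lmul_matrix symmetric_matrix_def transpose_matrix_vector)

lemma quadratic_form_expand:
  fixes M :: "real^'n^'n"
  assumes "symmetric_matrix M"
  shows "(v + t *\<^sub>R w) \<bullet> (M *v (v + t *\<^sub>R w))
           = v \<bullet> (M *v v) + 2 * t * (w \<bullet> (M *v v)) + t\<^sup>2 * (w \<bullet> (M *v w))"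
proof -
  have "v \<bullet> (M *v w) = w \<bullet> (M *v v)"
    using symmetric_matrix_inner[OF assms, of v w] by (simp add: inner_commute)
  then show ?thesis
    by (simp add: matrix_vector_right_distrib matrix_vector_mult_scaleR inner_add_left
        inner_add_right power2_eq_square algebra_simps)
qed

text \<open>Near \<open>t = 0\<close> a nonzero linear term dominates any quadratic one. This yields
  the first-order condition at a maximum of a quadratic form without differentiation.\<close>

lemma zero_if_linear_le_quadratic:
  fixes a C :: real
  assumes "\<And>t. t * a \<le> t\<^sup>2 * C"
  shows "a = 0"
proof (rule ccontr)
  assume "a \<noteq> 0"
  define t where "t = a / (1 + \<bar>C\<bar>)"
  have t: "a = t * (1 + \<bar>C\<bar>)" "t \<noteq> 0"
    using \<open>a \<noteq> 0\<close> by (auto simp: t_def add_nonneg_eq_0_iff)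
  have "t\<^sup>2 * (1 + \<bar>C\<bar>) \<le> t\<^sup>2 * C"
    using assms[of t] unfolding t(1) by (simp add: power2_eq_square mult.assoc)
  moreover have "t\<^sup>2 > 0"
    using t(2) by simp
  ultimately have "1 + \<bar>C\<bar> \<le> C"
    by (metis mult_le_cancel_left_pos)
  then show False by linarith
qed

text \<open>A maximiser \<open>v\<close> of the quadratic form on the compact unit sphere of
  \<open>S\<close> works: the first-order condition makes the residual
  \<open>M *v v - c *\<^sub>R v\<close> orthogonal to \<open>S\<close>, while invariance puts it
  into \<open>S\<close>, so it vanishes.\<close>

lemma symmetric_eigenvector_in_invariant_subspace:
  fixes M :: "real^'n^'n"
  assumes sym: "symmetric_matrix M" and S: "subspace S" and inv: "\<And>v. v \<in> S \<Longrightarrow> M *v v \<in> S"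
    and nz: "S \<noteq> {0}"
  obtains v c where "v \<in> S" "norm v = 1" "M *v v = c *\<^sub>R v"
proof -
  obtain w where w: "w \<in> S" "w \<noteq> 0"
    using S nz subspace_0 by blast
  have comp: "compact (sphere 0 1 \<inter> S)"
    using S closed_subspace by (intro compact_Int_closed) auto
  have ne: "sphere 0 1 \<inter> S \<noteq> {}"
  proof -
    have "(1 / norm w) *\<^sub>R w \<in> sphere 0 1 \<inter> S"
      using w S by (auto simp: subspace_scale)
    then show ?thesis by blast
  qed
  have "continuous_on (sphere 0 1 \<inter> S) (\<lambda>v. v \<bullet> (M *v v))"
    by (intro continuous_intros)
  then obtain v where v: "v \<in> sphere 0 1 \<inter> S"
    and max: "\<And>w. w \<in> sphere 0 1 \<inter> S \<Longrightarrow> w \<bullet> (M *v w) \<le> v \<bullet> (M *v v)"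
    using continuous_attains_sup[OF comp ne] by blast
  define c where "c = v \<bullet> (M *v v)"
  have vv: "v \<bullet> v = 1"
    using v by (simp add: norm_eq_1)
  have bound: "w \<bullet> (M *v w) \<le> c * (w \<bullet> w)" if "w \<in> S" for w
  proof (cases "w = 0")
    case False
    define z where "z = (1 / norm w) *\<^sub>R w"
    have z: "z \<in> sphere 0 1 \<inter> S"
      using that False S by (auto simp: z_def subspace_scale)
    have wz: "w = norm w *\<^sub>R z"
      using False by (simp add: z_def)
    have "w \<bullet> (M *v w) = (norm w)\<^sup>2 * (z \<bullet> (M *v z))"
      by (subst (1 2) wz) (simp add: matrix_vector_mult_scaleR power2_eq_square)
    also have "\<dots> \<le> (norm w)\<^sup>2 * c"
      using max[OF z] by (simp add: c_def mult_left_mono)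
    finally show ?thesis
      by (simp add: power2_norm_eq_inner mult.commute)
  qed simp
  \<comment> \<open>The perturbation \<open>v + t *\<^sub>R w\<close> need not be normalised, since
    \<open>bound\<close> is homogeneous. Its terms of order zero cancel, which leaves a linear term
    in \<open>t\<close> below a quadratic one.\<close>
  have orth: "w \<bullet> (M *v v - c *\<^sub>R v) = 0" if w: "w \<in> S" for w
  proof -
    have "t * (2 * (w \<bullet> (M *v v - c *\<^sub>R v))) \<le> t\<^sup>2 * (c * (w \<bullet> w) - w \<bullet> (M *v w))" for t
    proof -
      have "v + t *\<^sub>R w \<in> S"
        using v w S by (simp add: subspace_add subspace_scale)
      from bound[OF this] show ?thesis
        unfolding quadratic_form_expand[OF sym] c_def[symmetric]
        by (simp add: inner_add_left inner_add_right inner_diff_right vv inner_commute[of v w]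
            power2_eq_square algebra_simps)
    qed
    from zero_if_linear_le_quadratic[OF this] show ?thesis by simp
  qed
  have "M *v v - c *\<^sub>R v \<in> S"
    using v S inv by (simp add: subspace_diff subspace_scale)
  from orth[OF this] have "M *v v = c *\<^sub>R v"
    by simp
  with v that show thesis by auto
qed

text \<open>An orthonormal set of eigenvectors of greatest cardinality must span: its orthogonal
  complement is invariant under \<open>M\<close>, so a nonzero complement would contain one more
  unit eigenvector.\<close>

lemma symmetric_matrix_eigenbasis:
  fixes M :: "real^'n^'n"
  assumes sym: "symmetric_matrix M"
  obtains B where "pairwise orthogonal B" "\<And>v. v \<in> B \<Longrightarrow> norm v = 1"
    "\<And>v. v \<in> B \<Longrightarrow> \<exists>c. M *v v = c *\<^sub>R v" "finite B" "card B = CARD('n)"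
proof -
  define Q where "Q B \<longleftrightarrow> finite B \<and> pairwise orthogonal B \<and>
    (\<forall>v\<in>B. norm v = 1 \<and> (\<exists>c. M *v v = c *\<^sub>R v))" for B
  have ind: "independent B" if "Q B" for B
    using that unfolding Q_def by (intro pairwise_orthogonal_independent) auto
  have "card B < Suc CARD('n)" if "Q B" for B
    using independent_bound[OF ind[OF that]] by simp
  moreover have "Q {}"
    by (simp add: Q_def)
  ultimately obtain B where B: "Q B" and max: "\<And>B'. Q B' \<Longrightarrow> card B' \<le> card B"
    using ex_has_greatest_nat[of Q "{}" card "Suc CARD('n)"] less_imp_le by blast
  define S where "S = {w. \<forall>b\<in>B. b \<bullet> w = 0}"
  have "S = {0}"
  proof (rule ccontr)
    assume nz: "S \<noteq> {0}"
    have sub: "subspace S"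
      by (auto simp: S_def subspace_def inner_add_right)
    have inv: "M *v w \<in> S" if "w \<in> S" for w
      unfolding S_def
    proof safe
      fix b assume b: "b \<in> B"
      then obtain c where "M *v b = c *\<^sub>R b"
        using B by (auto simp: Q_def)
      then show "b \<bullet> (M *v w) = 0"
        using that b by (simp add: symmetric_matrix_inner[OF sym] S_def)
    qed
    obtain v c where v: "v \<in> S" "norm v = 1" "M *v v = c *\<^sub>R v"
      using symmetric_eigenvector_in_invariant_subspace[OF sym sub inv nz] by blast
    have "v \<notin> B"
      using v by (auto simp: S_def norm_eq_1)
    have "Q (insert v B)"
      using B v unfolding Q_def
      by (auto simp: pairwise_insert orthogonal_def S_def inner_commute)
    from max[OF this] \<open>v \<notin> B\<close> B show False
      by (simp add: Q_def)
  qed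
  have "x \<in> span B" for x
  proof -
    obtain y z where yz: "y \<in> span B" "\<And>w. w \<in> span B \<Longrightarrow> orthogonal z w" "x = y + z"
      using orthogonal_subspace_decomp_exists[of B x] by metis
    have "z \<in> S"
      using yz(2) by (auto simp: S_def span_base orthogonal_def inner_commute)
    then show ?thesis
      using yz \<open>S = {0}\<close> by simp
  qed
  then have "span B = UNIV" by blast
  then have "card B = CARD('n)"
    using dim_span_eq_card_independent[OF ind[OF B]] by simp
  then show thesis
    using that[of B] B unfolding Q_def by simp
qed

section \<open>Diagonal matrices, orthogonal conjugation and the spectral theorem\<close>

definition diagonal_matrix :: "('n \<Rightarrow> real) \<Rightarrow> real^'n^'n" where
  "diagonal_matrix d = (\<chi> i j. if i = j then d i else 0)"

lemma diagonal_matrix_mult: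
  "diagonal_matrix d ** diagonal_matrix e = diagonal_matrix (\<lambda>i. d i * e i)"
  for d e :: "'n::finite \<Rightarrow> real"
  by (auto simp: diagonal_matrix_def matrix_matrix_mult_def vec_eq_iff
      if_distrib[of "\<lambda>x. _ * x"] cong: if_cong)

lemma transpose_diagonal_matrix [simp]: "transpose (diagonal_matrix d) = diagonal_matrix d"
  by (auto simp: diagonal_matrix_def transpose_def vec_eq_iff)

lemma det_diagonal_matrix [simp]: "det (diagonal_matrix d) = (\<Prod>i\<in>UNIV. d i)"
  by (subst det_diagonal) (auto simp: diagonal_matrix_def)

lemma trace_diagonal_matrix [simp]: "trace (diagonal_matrix d) = (\<Sum>i\<in>UNIV. d i)"
  by (simp add: trace_def diagonal_matrix_def)

lemma inner_diagonal_matrix: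
  "v \<bullet> (diagonal_matrix d *v v) = (\<Sum>i\<in>UNIV. d i * (v $ i)\<^sup>2)"
  by (simp add: inner_vec_def diagonal_matrix_def matrix_vector_mult_def
      if_distrib[of "\<lambda>x. _ * x"] power2_eq_square mult_ac cong: if_cong)

lemma transpose_conjugation:
  "transpose (P ** M ** transpose P) = P ** transpose M ** transpose P" for M P :: "real^'n^'n"
  by (simp add: matrix_transpose_mul matrix_mul_assoc)

lemma inner_conjugation:
  "v \<bullet> ((P ** M ** transpose P) *v v) = (transpose P *v v) \<bullet> (M *v (transpose P *v v))"
  for M P :: "real^'n^'n"
  by (metis dot_lmul_matrix matrix_vector_mul_assoc transpose_matrix_vector)

lemma orthogonal_matrix_mult_cancel:
  fixes P :: "real^'n^'n"
  assumes "orthogonal_matrix P"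
  shows "transpose P ** (P ** X) = X" "X ** P ** transpose P = X" "X ** transpose P ** P = X"
proof -
  have P: "transpose P ** P = mat 1" "P ** transpose P = mat 1"
    using assms by (simp_all add: orthogonal_matrix_def)
  show "transpose P ** (P ** X) = X"
    by (simp add: matrix_mul_assoc P)
  show "X ** P ** transpose P = X" "X ** transpose P ** P = X"
    by (simp_all add: P flip: matrix_mul_assoc)
qed

lemma det_orthogonal_conjugation:
  fixes M P :: "real^'n^'n"
  assumes "orthogonal_matrix P"
  shows "det (P ** M ** transpose P) = det M"
  using det_orthogonal_matrix[OF assms] by (auto simp: det_mul)

lemma trace_orthogonal_conjugation:
  fixes M P :: "real^'n^'n"
  assumes "orthogonal_matrix P"
  shows "trace (P ** M ** transpose P) = trace M"
  by (simp add: trace_mul_sym[of "P ** M"] orthogonal_matrix_mult_cancel[OF assms])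

lemma orthogonal_conjugation_mult:
  fixes M N P :: "real^'n^'n"
  assumes "orthogonal_matrix P"
  shows "(P ** M ** transpose P) ** (P ** N ** transpose P) = P ** (M ** N) ** transpose P"
  by (simp add: orthogonal_matrix_mult_cancel[OF assms] flip: matrix_mul_assoc)

text \<open>The columns of \<open>P\<close> are the eigenbasis, indexed through a bijection with
  \<open>'n\<close>. The eigenvector equations are then
  \<open>M ** P = P ** diagonal_matrix d\<close> read column by column.\<close>

theorem symmetric_matrix_spectral:
  fixes M :: "real^'n^'n"
  assumes sym: "symmetric_matrix M"
  obtains P d where "orthogonal_matrix P" "M = P ** diagonal_matrix d ** transpose P"
proof -
  obtain B where B: "pairwise orthogonal B" "\<And>v. v \<in> B \<Longrightarrow> norm v = 1"
    "\<And>v. v \<in> B \<Longrightarrow> \<exists>c. M *v v = c *\<^sub>R v" "finite B" "card B = CARD('n)"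
    using symmetric_matrix_eigenbasis[OF sym] by blast
  obtain f where f: "bij_betw f (UNIV :: 'n set) B"
    using B(4,5) by (metis finite_class.finite_UNIV finite_same_card_bij)
  have fB: "f i \<in> B" for i
    using f by (auto simp: bij_betw_def)
  define P :: "real^'n^'n" where "P = (\<chi> i j. f j $ i)"
  have col: "column j P = f j" for j
    by (simp add: P_def column_def vec_eq_iff)
  have P: "orthogonal_matrix P"
    unfolding orthogonal_matrix_orthonormal_columns col
  proof (intro conjI allI impI)
    show "norm (f i) = 1" for i
      using B(2) fB by blast
    show "orthogonal (f i) (f j)" if "i \<noteq> j" for i j
    proof -
      have "f i \<noteq> f j"
        using f that by (auto simp: bij_betw_def dest: injD)
      then show ?thesis
        using B(1) fB by (simp add: pairwise_def)
    qed
  qed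
  have "\<forall>i. \<exists>c. M *v f i = c *\<^sub>R f i"
    using B(3) fB by blast
  then obtain d where d: "\<And>i. M *v f i = d i *\<^sub>R f i"
    by (auto dest!: choice)
  have "(M ** P) $ i $ j = (P ** diagonal_matrix d) $ i $ j" for i j
  proof -
    have "(M ** P) $ i $ j = (M *v f j) $ i"
      by (simp add: matrix_matrix_mult_def matrix_vector_mult_def P_def)
    also have "\<dots> = (P ** diagonal_matrix d) $ i $ j"
      by (simp add: d matrix_matrix_mult_def diagonal_matrix_def P_def if_distrib[of "\<lambda>x. _ * x"]
          mult.commute cong: if_cong)
    finally show ?thesis .
  qed
  then have "M ** P = P ** diagonal_matrix d"
    by (simp add: vec_eq_iff)
  then have "M = P ** diagonal_matrix d ** transpose P"
    using orthogonal_matrix_mult_cancel(2)[OF P, of M] by simp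
  with P that show thesis by blast
qed

text \<open>The vector \<open>P *v axis i 1\<close> is the \<open>i\<close>-th column of
  \<open>P\<close>, a unit eigenvector for \<open>d i\<close>. Thus the sign of each
  \<open>d i\<close> can be read off from the quadratic form.\<close>

lemma conjugated_diagonal_quadratic_form:
  fixes P :: "real^'n^'n"
  assumes "orthogonal_matrix P"
  shows "(P *v axis i 1) \<bullet> ((P ** diagonal_matrix d ** transpose P) *v (P *v axis i 1)) = d i"
proof -
  have "transpose P *v (P *v axis i 1) = axis i 1"
    using assms by (simp add: matrix_vector_mul_assoc orthogonal_matrix_def del: transpose_matrix_vector)
  then show ?thesis
    by (simp add: inner_conjugation inner_diagonal_matrix axis_def if_distrib if_distribR power2_eq_square
        del: transpose_matrix_vector cong: if_cong)
qed

section \<open>Trace against determinant: the AM-GM bound and its near-optimality\<close>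

lemma root_prod_le_mean:
  fixes d :: "'n::finite \<Rightarrow> real"
  assumes "\<And>i. d i \<ge> 0"
  shows "real CARD('n) * root CARD('n) (\<Prod>i\<in>UNIV. d i) \<le> (\<Sum>i\<in>UNIV. d i)"
proof -
  let ?n = "CARD('n)"
  have "root ?n (\<Prod>i\<in>UNIV. d i) = (\<Prod>i\<in>UNIV. d i) powr (1 / ?n)"
    using assms by (intro root_powr_inverse) (auto simp: prod_nonneg)
  also have "\<dots> \<le> (\<Sum>i\<in>UNIV. d i / ?n)"
    by (rule arith_geom_mean) (use assms in auto)
  also have "\<dots> = (\<Sum>i\<in>UNIV. d i) / ?n"
    by (simp add: sum_divide_distrib)
  finally show ?thesis
    by (simp add: field_simps)
qed

lemma positive_semidefinite_spectral:
  fixes M :: "real^'n^'n"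
  assumes "positive_semidefinite M"
  obtains P d where "orthogonal_matrix P" "M = P ** diagonal_matrix d ** transpose P" "\<forall>i. d i \<ge> 0"
proof -
  obtain P d where P: "orthogonal_matrix P" "M = P ** diagonal_matrix d ** transpose P"
    using assms symmetric_matrix_spectral unfolding positive_semidefinite_def by blast
  have "d i \<ge> 0" for i
    using assms conjugated_diagonal_quadratic_form[OF P(1), of i d]
    unfolding positive_semidefinite_def P(2)[symmetric] by metis
  then show thesis
    using that[OF P] by simp
qed

lemma det_nonneg_positive_semidefinite:
  fixes M :: "real^'n^'n"
  assumes "positive_semidefinite M"
  shows "det M \<ge> 0"
proof -
  obtain P d where P: "orthogonal_matrix P" "M = P ** diagonal_matrix d ** transpose P"
    "\<forall>i. d i \<ge> 0"
    using positive_semidefinite_spectral[OF assms] by metis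
  show ?thesis
    unfolding P(2) det_orthogonal_conjugation[OF P(1)] using P(3) by (simp add: prod_nonneg)
qed

text \<open>Orthogonal conjugation changes neither determinant nor trace, so this is AM-GM for the
  eigenvalues.\<close>

lemma root_det_le_trace:
  fixes M :: "real^'n^'n"
  assumes "positive_semidefinite M"
  shows "real CARD('n) * root CARD('n) (det M) \<le> trace M"
proof -
  obtain P d where P: "orthogonal_matrix P" "M = P ** diagonal_matrix d ** transpose P" "\<forall>i. d i \<ge> 0"
    using positive_semidefinite_spectral[OF assms] by metis
  show ?thesis
    unfolding P(2) det_orthogonal_conjugation[OF P(1)] trace_orthogonal_conjugation[OF P(1)]
    using root_prod_le_mean[of d] P(3) by simp
qed

lemma positive_semidefinite_congruence:
  fixes A H :: "real^'n^'n"
  assumes "positive_semidefinite H"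
  shows "positive_semidefinite (transpose A ** H ** A)"
  using assms inner_conjugation[of _ "transpose A" H] unfolding positive_semidefinite_def symmetric_matrix_def
  by (simp add: matrix_transpose_mul matrix_mul_assoc del: transpose_matrix_vector)

text \<open>The congruence has determinant \<open>(det A)\<^sup>2 * det H = det H\<close>, so the
  AM-GM bound for it is the same for all \<open>A\<close>.\<close>

lemma trace_congruence_ge:
  fixes A H :: "real^'n^'n"
  assumes "positive_semidefinite H" "det A = 1"
  shows "real CARD('n) * root CARD('n) (det H) \<le> trace (transpose A ** H ** A)"
  using root_det_le_trace[OF positive_semidefinite_congruence[OF assms(1)], of A] assms(2)
  by (simp add: det_mul)

text \<open>The constant is the least eigenvalue; it is positive because the nonnegative eigenvalues
  have a nonzero product.\<close>

lemma positive_definite_coercive: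
  fixes H :: "real^'n^'n"
  assumes psd: "positive_semidefinite H" and det: "det H \<noteq> 0"
  obtains m where "m > 0" "\<And>v. m * (norm v)\<^sup>2 \<le> v \<bullet> (H *v v)"
proof -
  obtain P d where P: "orthogonal_matrix P" "H = P ** diagonal_matrix d ** transpose P" "\<forall>i. d i \<ge> 0"
    using positive_semidefinite_spectral[OF psd] by metis
  have "d i \<noteq> 0" for i
    using det by (simp add: P det_orthogonal_conjugation)
  then have dpos: "d i > 0" for i
    using P(3)[rule_format, of i] by (simp add: less_le)
  define m where "m = Min (range d)"
  have m: "m > 0" "\<And>i. m \<le> d i"
    using dpos by (auto simp: m_def)
  have "m * (norm v)\<^sup>2 \<le> v \<bullet> (H *v v)" for v
  proof -
    define w where "w = transpose P *v v"
    have "norm w = norm v"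
      using inner_conjugation[of v P "mat 1"] P(1)
      by (simp add: w_def norm_eq_sqrt_inner orthogonal_matrix_def del: transpose_matrix_vector)
    then have "(norm v)\<^sup>2 = (norm w)\<^sup>2"
      by simp
    also have "\<dots> = (\<Sum>i\<in>UNIV. (w $ i)\<^sup>2)"
      unfolding power2_norm_eq_inner inner_vec_def by (simp add: power2_eq_square)
    finally have "m * (norm v)\<^sup>2 = (\<Sum>i\<in>UNIV. m * (w $ i)\<^sup>2)"
      by (simp add: sum_distrib_left)
    also have "\<dots> \<le> (\<Sum>i\<in>UNIV. d i * (w $ i)\<^sup>2)"
      by (intro sum_mono mult_right_mono m) auto
    also have "\<dots> = v \<bullet> (H *v v)"
      unfolding P(2) inner_conjugation inner_diagonal_matrix w_def ..
    finally show ?thesis .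
  qed
  with m that show thesis by blast
qed

text \<open>Equality in AM-GM asks for \<open>transpose A ** H ** A\<close> to be a multiple of the
  identity, which is impossible for singular \<open>H \<noteq> 0\<close>. Shifting the eigenvalues
  by a small \<open>s > 0\<close> makes them invertible, and the optimal \<open>A\<close> for the
  shifted matrix is nearly optimal for \<open>H\<close>.\<close>

lemma near_optimal_matrix:
  fixes H :: "real^'n^'n"
  assumes psd: "positive_semidefinite H" and "e > 0"
  obtains A where "positive_definite A" "det A = 1"
    "trace (transpose A ** H ** A) < real CARD('n) * root CARD('n) (det H) + e"
proof -
  let ?n = "CARD('n)"
  obtain P d where P: "orthogonal_matrix P" "H = P ** diagonal_matrix d ** transpose P" "\<forall>i. d i \<ge> 0"
    using positive_semidefinite_spectral[OF psd] by metis
  have detH: "det H = (\<Prod>i\<in>UNIV. d i)"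
    using P by (simp add: det_orthogonal_conjugation)
  \<comment> \<open>For \<open>s \<ge> 0\<close>, \<open>F s\<close> is the AM-GM bound for
    \<open>H + s I\<close>; its continuity at 0 bounds the cost of the shift.\<close>
  define F where "F s = real ?n * root ?n (\<Prod>i\<in>UNIV. d i + s)" for s :: real
  have "isCont F 0"
    unfolding F_def by (intro continuous_intros)
  then have "(F \<longlongrightarrow> F 0) (at_right 0)"
    by (simp add: isCont_def filterlim_at_split)
  moreover have "F 0 = real ?n * root ?n (det H)"
    by (simp add: F_def detH)
  ultimately have "\<forall>\<^sub>F s in at_right 0. F s < real ?n * root ?n (det H) + e"
    using \<open>e > 0\<close> by (intro order_tendstoD(2)[where a = "_ + e"]) auto
  then have "\<forall>\<^sub>F s in at_right 0. s > 0 \<and> F s < real ?n * root ?n (det H) + e"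
    by (intro eventually_conj) (auto simp: eventually_at_right_less)
  then obtain s where s: "s > 0" "F s < real ?n * root ?n (det H) + e"
    by (metis (mono_tags, lifting) eventually_happens' trivial_limit_at_right_real)
  define mu where "mu i = d i + s" for i
  have mu: "mu i > 0" "d i \<le> mu i" for i
    using P(3)[rule_format, of i] s by (auto simp: mu_def add_nonneg_pos)
  \<comment> \<open>With \<open>r\<close> the geometric mean of the shifted eigenvalues, the entries
    \<open>a i = sqrt (r / mu i)\<close> have product 1 and satisfy
    \<open>a i * mu i * a i = r\<close>, so the shifted matrix is carried to \<open>r\<close> times
    the identity.\<close>
  define r where "r = root ?n (\<Prod>i\<in>UNIV. mu i)"
  have r: "r > 0" "r ^ ?n = (\<Prod>i\<in>UNIV. mu i)"
    using prod_pos[of UNIV mu] mu by (simp_all add: r_def real_root_gt_zero real_root_pow_pos)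
  define a where "a i = sqrt (r / mu i)" for i
  have a: "a i > 0" "a i * a i = r / mu i" for i
    using r mu[of i] by (auto simp: a_def)
  define A where "A = P ** diagonal_matrix a ** transpose P"
  have "det A = (\<Prod>i\<in>UNIV. a i)"
    by (simp add: A_def det_orthogonal_conjugation P)
  moreover have "(\<Prod>i\<in>UNIV. a i) = 1"
  proof -
    have "(\<Prod>i\<in>UNIV. a i) * (\<Prod>i\<in>UNIV. a i) = (\<Prod>i\<in>UNIV. r / mu i)"
      by (simp add: prod.distrib[symmetric] a)
    also have "\<dots> = r ^ ?n / (\<Prod>i\<in>UNIV. mu i)"
      by (simp add: prod_dividef)
    also have "\<dots> = 1"
      using r(1) by (simp flip: r(2))
    finally have "(\<Prod>i\<in>UNIV. a i)\<^sup>2 = 1"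
      by (simp add: power2_eq_square)
    moreover have "(\<Prod>i\<in>UNIV. a i) > 0"
      using a by (simp add: prod_pos)
    ultimately show ?thesis
      by (simp add: power2_eq_1_iff)
  qed
  ultimately have detA: "det A = 1" by simp
  have tA: "transpose A = A"
    by (simp add: A_def transpose_conjugation)
  have pd: "positive_definite A"
    unfolding positive_definite_def symmetric_matrix_def
  proof (intro conjI allI impI tA)
    fix v :: "real^'n" assume "v \<noteq> 0"
    define w where "w = transpose P *v v"
    have "P *v w = v"
      using P(1) by (simp add: w_def matrix_vector_mul_assoc orthogonal_matrix_def del: transpose_matrix_vector)
    with \<open>v \<noteq> 0\<close> have "w \<noteq> 0" by auto
    then obtain i where "w $ i \<noteq> 0"
      by (auto simp: vec_eq_iff)
    then have "(\<Sum>i\<in>UNIV. a i * (w $ i)\<^sup>2) > 0"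
      using a(1) by (intro sum_pos2[of _ i]) (auto simp: less_imp_le)
    then show "0 < v \<bullet> (A *v v)"
      unfolding A_def inner_conjugation w_def[symmetric] inner_diagonal_matrix .
  qed
  have "transpose A ** H ** A = P ** diagonal_matrix (\<lambda>i. a i * d i * a i) ** transpose P"
    unfolding tA unfolding A_def P(2)
    by (simp add: orthogonal_conjugation_mult P diagonal_matrix_mult)
  then have "trace (transpose A ** H ** A) = (\<Sum>i\<in>UNIV. a i * a i * d i)"
    by (simp add: trace_orthogonal_conjugation P mult_ac)
  also have "\<dots> \<le> (\<Sum>i\<in>(UNIV::'n set). r)"
  proof (rule sum_mono)
    fix i
    have "r * d i \<le> r * mu i"
      using mu r by (intro mult_left_mono) auto
    then show "a i * a i * d i \<le> r"
      using mu(1)[of i] by (simp add: a field_simps)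
  qed
  also have "\<dots> = F s"
    by (simp add: F_def r_def mu_def)
  finally show thesis
    using that[OF pd detA] s by simp
qed

section \<open>Admissibility and the operator norm\<close>

text \<open>By Cauchy-Schwarz a norm bound controls the quadratic form. A fixed matrix thus becomes
  admissible as soon as \<open>\<phi> \<epsilon>\<close> exceeds a bound for its norm.\<close>

lemma admissible_matrices_ge_norm:
  fixes A :: "real^'n^'n"
  assumes "positive_definite A" "det A = 1" "\<And>v. norm (A *v v) \<le> c * norm v"
  shows "A \<in> admissible_matrices c"
  unfolding admissible_matrices_def loewner_le_def positive_semidefinite_def
proof (safe intro!: assms(1,2))
  have "transpose A = A"
    using assms(1) by (simp add: positive_definite_def symmetric_matrix_def)
  then show "symmetric_matrix (c *\<^sub>R mat 1 - A)"
    by (simp add: symmetric_matrix_def transpose_def vec_eq_iff mat_def)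
  fix v
  have "v \<bullet> (A *v v) \<le> norm v * norm (A *v v)"
    by (rule norm_cauchy_schwarz)
  also have "\<dots> \<le> norm v * (c * norm v)"
    using assms(3) by (intro mult_left_mono) auto
  also have "\<dots> = c * (v \<bullet> v)"
    by (metis mult.assoc mult.commute norm_eq_square power2_norm_eq_inner power2_eq_square)
  finally show "0 \<le> v \<bullet> ((c *\<^sub>R mat 1 - A) *v v)"
    by (simp add: matrix_vector_mult_diff_rdistrib inner_diff_right scaleR_matrix_vector_assoc[symmetric])
qed

text \<open>From \<open>0 \<le> A \<le> c\<close> one gets
  \<open>A\<^sup>2 \<le> c A \<le> c\<^sup>2\<close> in the Loewner order, and
  \<open>|Av|\<^sup>2\<close> is the quadratic form of \<open>A\<^sup>2\<close>. Hence an admissible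
  matrix maps the ball of radius \<open>\<epsilon>\<close> into the one of radius
  \<open>\<epsilon> * \<phi> \<epsilon>\<close>.\<close>

lemma admissible_matrices_norm_le:
  fixes A :: "real^'n^'n"
  assumes A: "A \<in> admissible_matrices c" and c: "c > 0"
  shows "norm (A *v v) \<le> c * norm v"
proof -
  define B where "B = c *\<^sub>R mat 1 - A"
  have sA: "symmetric_matrix A" and pA: "\<And>v. v \<bullet> (A *v v) \<ge> 0"
    and sB: "symmetric_matrix B" and pB: "\<And>v. v \<bullet> (B *v v) \<ge> 0"
    using A by (auto simp: admissible_matrices_def loewner_le_def positive_semidefinite_def
        positive_definite_def B_def) (metis inner_zero_left less_imp_le order_refl)
  define w where "w = A *v v"
  have Bv: "B *v x = c *\<^sub>R x - A *v x" for x
    by (simp add: B_def matrix_vector_mult_diff_rdistrib scaleR_matrix_vector_assoc[symmetric])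
  have ww: "v \<bullet> (A *v w) = w \<bullet> w"
    by (simp add: symmetric_matrix_inner[OF sA] w_def)
  \<comment> \<open>\<open>A\<close> and \<open>B = c - A\<close> commute and \<open>A + B = c\<close>, so \<open>c A B = A B A + B A B\<close> is semidefinite.\<close>
  have "0 \<le> w \<bullet> (B *v w) + (B *v v) \<bullet> (A *v (B *v v))"
    using pA pB by simp
  also have "\<dots> = c * (c * (v \<bullet> w) - w \<bullet> w)"
    by (simp add: Bv w_def[symmetric] matrix_vector_mult_diff_distrib matrix_vector_mult_scaleR
        inner_diff_left inner_diff_right ww inner_commute algebra_simps)
  finally have "w \<bullet> w \<le> c * (v \<bullet> w)"
    using c by (simp add: zero_le_mult_iff)
  also have "\<dots> \<le> c * (c * (v \<bullet> v))"
    using pB[of v] c by (intro mult_left_mono) (auto simp: Bv inner_diff_right w_def)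
  finally have "(norm w)\<^sup>2 \<le> (c * norm v)\<^sup>2"
    by (simp add: power2_norm_eq_inner power_mult_distrib) (simp add: power2_eq_square mult.assoc)
  then show ?thesis
    unfolding w_def by (rule power2_le_imp_le) (use c in simp)
qed

section \<open>Means over balls\<close>

lemma prod_inner_Basis_cart: "(\<Prod>b\<in>Basis. v \<bullet> b) = (\<Prod>i\<in>UNIV. v $ i)" for v :: "real^'n"
proof -
  have B: "(Basis :: (real^'n) set) = range (\<lambda>i. axis i 1)"
    by (auto simp: Basis_vec_def)
  have "inj (\<lambda>i::'n. axis i (1::real))"
    by (auto simp: inj_on_def axis_eq_axis)
  then show ?thesis
    unfolding B by (subst prod.reindex) (simp_all add: inner_axis)
qed

text \<open>Lebesgue measure is determined by its values on boxes, and the preimage of a box under a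
  signed permutation is a box with the same side lengths in another order.\<close>

lemma distr_lborel_signed_permutation:
  fixes s :: "'n::finite \<Rightarrow> real" and p :: "'n \<Rightarrow> 'n"
  assumes s: "\<And>i. s i = 1 \<or> s i = -1" and p: "bij p"
  shows "distr lborel borel (\<lambda>y::real^'n. \<chi> i. s i * y $ p i) = lborel"
proof (rule sym, rule lborel_eqI)
  let ?T = "\<lambda>y::real^'n. \<chi> i. s i * y $ p i"
  fix l u :: "real^'n"
  assume le: "\<And>b. b \<in> Basis \<Longrightarrow> l \<bullet> b \<le> u \<bullet> b"
  have T: "?T \<in> borel_measurable lborel"
    by (simp, intro borel_measurable_continuous_onI continuous_intros)
  define q where "q = inv p"
  have pq: "p (q j) = j" "q (p j) = j" for j
    using p by (simp_all add: q_def bij_is_inj bij_is_surj surj_f_inv_f)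
  \<comment> \<open>A negative sign swaps and negates the two endpoints of a side; \<open>q\<close>
    moves each side back to its original coordinate.\<close>
  define l' where "l' = (\<chi> j. if s (q j) = 1 then l $ q j else - u $ q j)"
  define u' where "u' = (\<chi> j. if s (q j) = 1 then u $ q j else - l $ q j)"
  have vim: "?T -` box l u = box l' u'"
  proof (intro set_eqI)
    fix y
    have "y \<in> ?T -` box l u \<longleftrightarrow> (\<forall>i. l $ i < s i * y $ p i \<and> s i * y $ p i < u $ i)"
      by (simp add: mem_box_cart)
    also have "\<dots> \<longleftrightarrow> (\<forall>j. l $ q j < s (q j) * y $ j \<and> s (q j) * y $ j < u $ q j)"
      by (metis pq)
    also have "\<dots> \<longleftrightarrow> (\<forall>j. l' $ j < y $ j \<and> y $ j < u' $ j)"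
    proof (rule all_cong1)
      fix j
      show "(l $ q j < s (q j) * y $ j \<and> s (q j) * y $ j < u $ q j) \<longleftrightarrow> (l' $ j < y $ j \<and> y $ j < u' $ j)"
        using s[of "q j"] by (auto simp: l'_def u'_def)
    qed
    finally show "y \<in> ?T -` box l u \<longleftrightarrow> y \<in> box l' u'"
      by (simp add: mem_box_cart)
  qed
  have le': "l $ i \<le> u $ i" for i
    using le[of "axis i 1"] by (simp add: inner_axis)
  have "emeasure (distr lborel borel ?T) (box l u) = emeasure lborel (box l' u')"
    using T by (simp add: emeasure_distr vim)
  also have "\<dots> = (\<Prod>b\<in>Basis. (u' - l') \<bullet> b)"
  proof (rule emeasure_lborel_box)
    fix b :: "real^'n" assume "b \<in> Basis"
    then obtain j where "b = axis j 1" by (auto simp: Basis_vec_def)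
    then show "l' \<bullet> b \<le> u' \<bullet> b"
      using le'[of "q j"] by (simp add: inner_axis l'_def u'_def)
  qed
  also have "(\<Prod>b\<in>Basis. (u' - l') \<bullet> b) = (\<Prod>j\<in>UNIV. (u - l) $ q j)"
    unfolding prod_inner_Basis_cart by (intro prod.cong) (auto simp: l'_def u'_def)
  also have "\<dots> = (\<Prod>i\<in>UNIV. (u - l) $ i)"
    using prod.reindex_bij_betw[of q UNIV UNIV "\<lambda>i. (u - l) $ i"] p
    by (simp add: q_def bij_imp_bij_inv)
  finally show "emeasure (distr lborel borel ?T) (box l u) = (\<Prod>b\<in>Basis. (u - l) \<bullet> b)"
    unfolding prod_inner_Basis_cart .
qed simp

lemma norm_signed_permutation:
  fixes s :: "'n::finite \<Rightarrow> real" and p :: "'n \<Rightarrow> 'n" and y :: "real^'n"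
  assumes s: "\<And>i. s i = 1 \<or> s i = -1" and p: "bij p"
  shows "norm (\<chi> i. s i * y $ p i) = norm y"
proof -
  have "(s i * y $ p i)\<^sup>2 = (y $ p i)\<^sup>2" for i
    using s[of i] by auto
  then show ?thesis
    using sum.reindex_bij_betw[OF p, of "\<lambda>i. (y $ i)\<^sup>2"] by (simp add: norm_vec_def L2_set_def)
qed

section \<open>The mean over a ball: linearity, monotonicity and symmetries\<close>

text \<open>The mean is a functional of an arbitrary integrand, so that it applies to Taylor
  polynomials as well as to \<open>u\<close>.\<close>

definition cball_mean :: "real \<Rightarrow> (real ^ 'n::finite \<Rightarrow> real) \<Rightarrow> real" where
  "cball_mean r f = 1 / measure lebesgue (cball (0 :: real ^ 'n) r) * (LINT y:cball 0 r|lebesgue. f y)"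

lemma ball_average_eq_cball_mean: "ball_average u x A r = cball_mean r (\<lambda>y. u (x + A *v y))"
  by (simp add: ball_average_def cball_mean_def)

lemma measure_lebesgue_cball:
  "r \<ge> 0 \<Longrightarrow> measure lebesgue (cball (0 :: real^'n) r) = unit_ball_vol CARD('n) * r ^ CARD('n)"
  using content_cball[of r "0 :: real^'n"] by simp

lemma measure_lebesgue_cball_pos: "r > 0 \<Longrightarrow> measure lebesgue (cball (0 :: real^'n) r) > 0"
  by (subst measure_lebesgue_cball) auto

text \<open>These facts link \<open>lebesgue\<close>, over which the means are defined, with
  \<open>lborel\<close>, where changes of variables are carried out: the cut-off integrand is Borel
  measurable, so completion leaves its integral unchanged.\<close>

lemma
  fixes f :: "real^'n \<Rightarrow> real"
  assumes f: "continuous_on (cball 0 r) f"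
  shows set_integrable_cball: "set_integrable lebesgue (cball 0 r) f"
    and set_integral_cball_lborel:
      "(LINT y:cball 0 r|lebesgue. f y) = (LINT y|lborel. indicator (cball 0 r) y * f y)"
    and borel_measurable_indicator_cball: "(\<lambda>y. indicator (cball 0 r) y * f y) \<in> borel_measurable borel"
proof -
  have i: "integrable lborel (\<lambda>y. indicator (cball 0 r) y * f y)"
    using borel_integrable_compact[OF compact_cball f] by simp
  then show m: "(\<lambda>y. indicator (cball 0 r) y * f y) \<in> borel_measurable borel"
    by (metis borel_measurable_integrable measurable_lborel2)
  show "set_integrable lebesgue (cball 0 r) f"
    unfolding set_integrable_def using i m by (simp add: integrable_completion)
  show "(LINT y:cball 0 r|lebesgue. f y) = (LINT y|lborel. indicator (cball 0 r) y * f y)"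
    unfolding set_lebesgue_integral_def using m by (simp add: integral_completion)
qed

lemma cball_mean_const: "r > 0 \<Longrightarrow> cball_mean r (\<lambda>y::real^'n. c) = c"
proof -
  assume r: "r > 0"
  then have "emeasure lebesgue (cball (0 :: real^'n) r) \<noteq> \<infinity>"
    using emeasure_cball[of r "0 :: real^'n"] by simp
  then have "(LINT y:cball (0 :: real^'n) r|lebesgue. c) = measure lebesgue (cball (0 :: real^'n) r) *\<^sub>R c"
    by (intro set_integral_const) auto
  then show ?thesis
    using measure_lebesgue_cball_pos[OF r, where 'n='n] unfolding cball_mean_def by simp
qed

lemma cball_mean_add:
  assumes "continuous_on (cball 0 r) f" "continuous_on (cball 0 r) g"
  shows "cball_mean r (\<lambda>y. f y + g y) = cball_mean r f + cball_mean r g"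
  using set_integrable_cball[OF assms(1)] set_integrable_cball[OF assms(2)]
  by (simp add: cball_mean_def set_integral_add distrib_left add_divide_distrib)

lemma cball_mean_mult_left: "cball_mean r (\<lambda>y. c * f y) = c * cball_mean r f"
  by (simp add: cball_mean_def)

lemma cball_mean_sum:
  assumes "finite I" "\<And>i. i \<in> I \<Longrightarrow> continuous_on (cball 0 r) (f i)" "r > 0"
  shows "cball_mean r (\<lambda>y. \<Sum>i\<in>I. f i y) = (\<Sum>i\<in>I. cball_mean r (f i))"
  using assms
proof (induction I rule: finite_induct)
  case empty
  then show ?case using cball_mean_const[of r 0] by simp
next
  case (insert i I)
  then show ?case
    by (simp add: cball_mean_add continuous_on_sum)
qed

lemma cball_mean_mono:
  assumes "continuous_on (cball 0 r) f" "continuous_on (cball 0 r) g"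
    and "\<And>y. norm y \<le> r \<Longrightarrow> f y \<le> g y"
  shows "cball_mean r f \<le> cball_mean r g"
  unfolding cball_mean_def
  using assms by (intro mult_left_mono set_integral_mono set_integrable_cball) auto

text \<open>Signed permutations preserve both the ball and \<open>lborel\<close>. All relations
  between first and second moments below are instances of this symmetry.\<close>

lemma cball_mean_signed_permutation:
  fixes f :: "real^'n \<Rightarrow> real" and s :: "'n \<Rightarrow> real" and p :: "'n \<Rightarrow> 'n"
  assumes f: "continuous_on (cball 0 r) f" and s: "\<And>i. s i = 1 \<or> s i = -1" and p: "bij p"
  shows "cball_mean r (\<lambda>y. f (\<chi> i. s i * y $ p i)) = cball_mean r f"
proof -
  let ?T = "\<lambda>y::real^'n. \<chi> i. s i * y $ p i"
  let ?g = "\<lambda>y. indicator (cball 0 r) y * f y"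
  have n: "norm (?T y) = norm y" for y
    by (rule norm_signed_permutation[OF s p])
  have T: "?T \<in> borel_measurable borel"
    by (intro borel_measurable_continuous_onI continuous_intros)
  have "continuous_on (cball 0 r) (\<lambda>y. f (?T y))"
    by (rule continuous_on_compose2[OF f]) (auto simp: n intro!: continuous_intros)
  then have "(LINT y:cball 0 r|lebesgue. f (?T y)) = (LINT y|lborel. ?g (?T y))"
    by (simp add: set_integral_cball_lborel indicator_def n)
  also have "\<dots> = (LINT y|distr lborel borel ?T. ?g y)"
    using T borel_measurable_indicator_cball[OF f] by (intro integral_distr[symmetric]) simp_all
  also have "\<dots> = (LINT y:cball 0 r|lebesgue. f y)"
    by (simp add: distr_lborel_signed_permutation[OF s p] set_integral_cball_lborel[OF f])
  finally show ?thesis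
    by (simp add: cball_mean_def)
qed

lemma cball_mean_reflect:
  fixes f :: "real^'n \<Rightarrow> real"
  assumes "continuous_on (cball 0 r) f"
  shows "cball_mean r (\<lambda>y. f (- y)) = cball_mean r f"
proof -
  have "(\<chi> i. - 1 * y $ id i) = - y" for y :: "real^'n"
    by (simp add: vec_eq_iff)
  then show ?thesis
    using cball_mean_signed_permutation[OF assms, of "\<lambda>_. -1" id] by simp
qed

text \<open>The integrand is odd, so reflection turns the mean into its own negative.\<close>

lemma cball_mean_inner:
  fixes b :: "real^'n"
  shows "cball_mean r (\<lambda>y. b \<bullet> y) = 0"
proof -
  have "cball_mean r (\<lambda>y. b \<bullet> y) = cball_mean r (\<lambda>y. b \<bullet> (- y))"
    by (rule cball_mean_reflect[symmetric]) (intro continuous_intros)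
  also have "\<dots> = - cball_mean r (\<lambda>y. b \<bullet> y)"
    using cball_mean_mult_left[of r "-1" "\<lambda>y. b \<bullet> y"] by simp
  finally show ?thesis by simp
qed

text \<open>Flipping the sign of the \<open>i\<close>-th coordinate alone negates the
  integrand.\<close>

lemma cball_mean_offdiagonal:
  fixes i j :: "'n::finite"
  assumes "i \<noteq> j"
  shows "cball_mean r (\<lambda>y::real^'n. y $ i * y $ j) = 0"
proof -
  have "cball_mean r (\<lambda>y::real^'n. y $ i * y $ j) = cball_mean r (\<lambda>y::real^'n. - 1 * (y $ i * y $ j))"
    using cball_mean_signed_permutation[of r "\<lambda>y::real^'n. y $ i * y $ j" "\<lambda>k. if k = i then -1 else 1" id]
      assms by (simp add: continuous_intros)
  also have "\<dots> = - cball_mean r (\<lambda>y::real^'n. y $ i * y $ j)"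
    by (subst cball_mean_mult_left) simp
  finally show ?thesis by simp
qed

lemma cball_mean_coordinate_square_eq:
  "cball_mean r (\<lambda>y::real^'n. y $ i * y $ i) = cball_mean r (\<lambda>y::real^'n. y $ j * y $ j)"
  using cball_mean_signed_permutation[of r "\<lambda>y::real^'n. y $ j * y $ j" "\<lambda>k. 1" "Transposition.transpose i j"]
  by (simp add: continuous_intros)

section \<open>Second moments of the ball\<close>

lemma integral_lborel_scaleR:
  fixes g :: "real^'n \<Rightarrow> real"
  assumes "g \<in> borel_measurable borel" "c > 0"
  shows "(LINT y|lborel. g y) = c ^ CARD('n) * (LINT y|lborel. g (c *\<^sub>R y))"
proof -
  have "(LINT y|lborel. g y) = (LINT y|density (distr lborel borel (\<lambda>y. 0 + c *\<^sub>R y)) (\<lambda>_. ennreal (\<bar>c\<bar> ^ CARD('n))). g y)"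
    using lborel_affine[of c "0::real^'n"] assms(2) by simp
  also have "\<dots> = (LINT y|distr lborel borel (\<lambda>y. 0 + c *\<^sub>R y). c ^ CARD('n) * g y)"
    using assms by (subst integral_density) auto
  also have "\<dots> = (LINT y|lborel. c ^ CARD('n) * g (c *\<^sub>R y))"
    using assms(1) by (subst integral_distr) auto
  finally show ?thesis by simp
qed

text \<open>A one-sided minimum fixes only the sign of the derivative. Two opposite inequalities,
  each an equality at \<open>a\<close>, together determine a value.\<close>

lemma derivative_nonneg_at_minimum_right:
  fixes f :: "real \<Rightarrow> real"
  assumes "(f has_real_derivative D) (at a)" "\<And>b. b \<ge> a \<Longrightarrow> f b \<ge> f a"
  shows "D \<ge> 0"
proof (rule ccontr)
  assume "\<not> D \<ge> 0"
  then obtain d where "d > 0" "\<And>h. 0 < h \<Longrightarrow> h < d \<Longrightarrow> f (a + h) < f a"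
    using DERIV_neg_dec_right[OF assms(1)] by auto
  from this(2)[of "d / 2"] this(1) assms(2)[of "a + d / 2"] show False by simp
qed

text \<open>Comparing the shell \<open>1 \<le> |y| \<le> b\<close> with its volume gives bounds on
  \<open>J (b ^ (n + 2) - 1)\<close> that agree to first order as \<open>b\<close> tends to 1.\<close>

lemma second_moment_unit_cball:
  defines "J \<equiv> (LINT y|lborel. indicator (cball 0 1) y * ((y :: real^'n) \<bullet> y))"
  shows "J * (real CARD('n) + 2) = unit_ball_vol CARD('n) * real CARD('n)"
proof -
  let ?n = "CARD('n)"
  define V :: real where "V = unit_ball_vol ?n"
  define I where "I b y = (indicator (cball 0 b) y :: real)" for b and y :: "real^'n"
  have cont: "continuous_on (cball 0 b) (\<lambda>y::real^'n. y \<bullet> y)" for b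
    by (intro continuous_intros)
  \<comment> \<open>The exponent collects \<open>?n\<close> from the dilation of volume and 2 from
    the integrand.\<close>
  have J: "(LINT y|lborel. I b y * (y \<bullet> y)) = J * b ^ (?n + 2)" if "b > 0" for b
  proof -
    have "(LINT y|lborel. I b y * (y \<bullet> y)) = b ^ ?n * (LINT y|lborel. I b (b *\<^sub>R y) * ((b *\<^sub>R y) \<bullet> (b *\<^sub>R y)))"
      unfolding I_def by (rule integral_lborel_scaleR[OF borel_measurable_indicator_cball[OF cont] that])
    also have "(\<lambda>y. I b (b *\<^sub>R y) * ((b *\<^sub>R y) \<bullet> (b *\<^sub>R y))) = (\<lambda>y. b\<^sup>2 * (I 1 y * (y \<bullet> y)))"
      using that by (auto simp: I_def indicator_def power2_eq_square)
    finally show ?thesis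
      unfolding J_def I_def by (simp add: power_add power2_eq_square)
  qed
  have V: "(LINT y|lborel. I b y) = V * b ^ ?n" if "b > 0" for b
    using content_cball[of b "0::real^'n"] that by (simp add: I_def[abs_def] V_def)
  have iJ: "integrable lborel (\<lambda>y. I b y * (y \<bullet> y))" for b
    using borel_integrable_compact[OF compact_cball cont] by (simp add: I_def[abs_def])
  have iV: "integrable lborel (I b)" for b
    using borel_integrable_compact[OF compact_cball, of 0 b "\<lambda>_. 1::real"] by (simp add: I_def[abs_def])
  have lower: "V * (b ^ ?n - 1) \<le> J * (b ^ (?n + 2) - 1)"
    and upper: "J * (b ^ (?n + 2) - 1) \<le> b\<^sup>2 * (V * (b ^ ?n - 1))" if b: "b \<ge> 1" for b
  proof -
    have p1: "I b y - I 1 y \<le> I b y * (y \<bullet> y) - I 1 y * (y \<bullet> y)"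
      and p2: "I b y * (y \<bullet> y) - I 1 y * (y \<bullet> y) \<le> b\<^sup>2 * (I b y - I 1 y)" for y
    proof -
      consider "norm y \<le> 1" | "1 < norm y" "norm y \<le> b" | "b < norm y"
        by linarith
      then have "I b y - I 1 y \<le> I b y * (y \<bullet> y) - I 1 y * (y \<bullet> y) \<and>
        I b y * (y \<bullet> y) - I 1 y * (y \<bullet> y) \<le> b\<^sup>2 * (I b y - I 1 y)"
      proof cases
        case 2
        then have "1 \<le> (norm y)\<^sup>2" "(norm y)\<^sup>2 \<le> b\<^sup>2"
          by (simp_all add: power_mono)
        then show ?thesis
          using 2 by (simp add: I_def indicator_def power2_norm_eq_inner)
      qed (use b in \<open>simp_all add: I_def indicator_def\<close>)
      then show "I b y - I 1 y \<le> I b y * (y \<bullet> y) - I 1 y * (y \<bullet> y)"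
        "I b y * (y \<bullet> y) - I 1 y * (y \<bullet> y) \<le> b\<^sup>2 * (I b y - I 1 y)"
        by blast+
    qed
    have eJ: "(LINT y|lborel. I b y * (y \<bullet> y) - I 1 y * (y \<bullet> y)) = J * (b ^ (?n + 2) - 1)"
      using b J[of b] J[of 1] by (simp add: iJ algebra_simps)
    have eV: "(LINT y|lborel. I b y - I 1 y) = V * (b ^ ?n - 1)"
      using b V[of b] V[of 1] by (simp add: iV algebra_simps)
    show "V * (b ^ ?n - 1) \<le> J * (b ^ (?n + 2) - 1)"
      unfolding eJ[symmetric] eV[symmetric] by (intro integral_mono p1) (simp_all add: iJ iV)
    have "J * (b ^ (?n + 2) - 1) \<le> (LINT y|lborel. b\<^sup>2 * (I b y - I 1 y))"
      unfolding eJ[symmetric] by (intro integral_mono p2) (simp_all add: iJ iV)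
    then show "J * (b ^ (?n + 2) - 1) \<le> b\<^sup>2 * (V * (b ^ ?n - 1))"
      by (simp add: eV)
  qed
  \<comment> \<open>Both sides of \<open>lower\<close> and of \<open>upper\<close> vanish at
    \<open>b = 1\<close>, so their right derivatives there are ordered. In \<open>upper\<close> the
    factor \<open>b\<^sup>2\<close> multiplies a term that vanishes at 1, hence its own derivative
    does not contribute.\<close>
  have "0 \<le> J * real (?n + 2) - V * real ?n"
  proof (rule derivative_nonneg_at_minimum_right)
    show "((\<lambda>b. J * (b ^ (?n + 2) - 1) - V * (b ^ ?n - 1)) has_real_derivative
      J * real (?n + 2) - V * real ?n) (at 1)"
      by (auto intro!: derivative_eq_intros)
  qed (use lower in auto)
  moreover have "0 \<le> V * real ?n - J * real (?n + 2)"
  proof (rule derivative_nonneg_at_minimum_right)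
    show "((\<lambda>b. b\<^sup>2 * (V * (b ^ ?n - 1)) - J * (b ^ (?n + 2) - 1)) has_real_derivative
      V * real ?n - J * real (?n + 2)) (at 1)"
      by (auto intro!: derivative_eq_intros)
  qed (use upper in auto)
  ultimately show ?thesis
    by (simp add: V_def add.commute)
qed

text \<open>Dilation reduces this to the unit ball, and \<open>r ^ CARD('n)\<close> cancels against
  the volume.\<close>

lemma cball_mean_norm_square:
  assumes r: "r > 0"
  shows "cball_mean r (\<lambda>y::real^'n. y \<bullet> y) = real CARD('n) / (real CARD('n) + 2) * r\<^sup>2"
proof -
  let ?n = "CARD('n)"
  have cont: "continuous_on (cball 0 r) (\<lambda>y::real^'n. y \<bullet> y)"
    by (intro continuous_intros)
  define J where "J = (LINT y|lborel. indicator (cball 0 1) y * ((y :: real^'n) \<bullet> y))"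
  have "(LINT y:cball 0 r|lebesgue. (y :: real^'n) \<bullet> y) =
    r ^ ?n * (LINT y|lborel. indicator (cball 0 r) (r *\<^sub>R y) * ((r *\<^sub>R (y :: real^'n)) \<bullet> (r *\<^sub>R y)))"
    unfolding set_integral_cball_lborel[OF cont]
    by (rule integral_lborel_scaleR[OF borel_measurable_indicator_cball[OF cont] r])
  also have "(\<lambda>y. indicator (cball 0 r) (r *\<^sub>R y) * ((r *\<^sub>R (y :: real^'n)) \<bullet> (r *\<^sub>R y)))
    = (\<lambda>y. r\<^sup>2 * (indicator (cball 0 1) y * (y \<bullet> y)))"
    using r by (auto simp: indicator_def power2_eq_square)
  finally have "(LINT y:cball 0 r|lebesgue. (y :: real^'n) \<bullet> y) = r ^ ?n * (r\<^sup>2 * J)"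
    by (simp add: J_def)
  then have mean: "cball_mean r (\<lambda>y::real^'n. y \<bullet> y) = r\<^sup>2 * (J / unit_ball_vol ?n)"
    using r unfolding cball_mean_def by (subst measure_lebesgue_cball) simp_all
  have "J * (real ?n + 2) = real ?n * unit_ball_vol ?n"
    using second_moment_unit_cball[where 'n='n] unfolding J_def by (simp add: mult.commute)
  moreover have "unit_ball_vol (real ?n) \<noteq> 0"
    by (metis less_irrefl of_nat_0_le_iff unit_ball_vol_pos)
  ultimately have "J / unit_ball_vol ?n = real ?n / (real ?n + 2)"
    by (subst frac_eq_eq) (simp_all add: add_nonneg_eq_0_iff)
  with mean show ?thesis by (simp only: mult.commute)
qed

text \<open>By symmetry every coordinate has an equal share of the mean of
  \<open>y \<bullet> y\<close>.\<close>

lemma cball_mean_coordinate_square: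
  assumes r: "r > 0"
  shows "cball_mean r (\<lambda>y::real^'n. y $ i * y $ i) = r\<^sup>2 / (real CARD('n) + 2)"
proof -
  have "real CARD('n) / (real CARD('n) + 2) * r\<^sup>2 = cball_mean r (\<lambda>y::real^'n. \<Sum>j\<in>UNIV. y $ j * y $ j)"
    using cball_mean_norm_square[OF r, where 'n='n] by (simp add: inner_vec_def)
  also have "\<dots> = (\<Sum>j\<in>UNIV. cball_mean r (\<lambda>y::real^'n. y $ j * y $ j))"
    by (intro cball_mean_sum r continuous_intros) auto
  also have "\<dots> = (\<Sum>j\<in>(UNIV :: 'n set). cball_mean r (\<lambda>y::real^'n. y $ i * y $ i))"
    by (intro sum.cong refl cball_mean_coordinate_square_eq)
  also have "\<dots> = real CARD('n) * cball_mean r (\<lambda>y::real^'n. y $ i * y $ i)"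
    by simp
  finally have "real CARD('n) * (r\<^sup>2 / (real CARD('n) + 2)) =
      real CARD('n) * cball_mean r (\<lambda>y::real^'n. y $ i * y $ i)"
    by simp
  then show ?thesis
    unfolding mult_cancel_left by simp
qed

lemma cball_mean_quadratic_form:
  fixes M :: "real^'n^'n"
  assumes r: "r > 0"
  shows "cball_mean r (\<lambda>y. y \<bullet> (M *v y)) = r\<^sup>2 / (real CARD('n) + 2) * trace M"
proof -
  have "cball_mean r (\<lambda>y. y \<bullet> (M *v y)) = cball_mean r (\<lambda>y. \<Sum>i\<in>UNIV. \<Sum>j\<in>UNIV. M $ i $ j * (y $ i * y $ j))"
    by (simp add: inner_vec_def matrix_vector_mult_def sum_distrib_left mult_ac)
  also have "\<dots> = (\<Sum>i\<in>UNIV. \<Sum>j\<in>UNIV. M $ i $ j * cball_mean r (\<lambda>y. y $ i * y $ j))"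
    using r by (simp add: cball_mean_sum cball_mean_mult_left continuous_intros)
  also have "\<dots> = (\<Sum>i\<in>UNIV. \<Sum>j\<in>UNIV. if j = i then M $ i $ i * (r\<^sup>2 / (real CARD('n) + 2)) else 0)"
    by (intro sum.cong refl) (auto simp: cball_mean_offdiagonal cball_mean_coordinate_square[OF r])
  also have "\<dots> = r\<^sup>2 / (real CARD('n) + 2) * trace M"
    by (simp add: trace_def sum_distrib_left sum_divide_distrib mult.commute)
  finally show ?thesis .
qed

section \<open>Second-order Taylor expansion\<close>

lemma has_derivative_gradient:
  fixes u :: "real^'n \<Rightarrow> real"
  assumes "u differentiable (at x)"
  shows "(u has_derivative (\<lambda>h. gradient u x \<bullet> h)) (at x)"
proof -
  have D: "(u has_derivative frechet_derivative u (at x)) (at x)"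
    using assms frechet_derivative_works by blast
  have "frechet_derivative u (at x) h = gradient u x \<bullet> h" for h
  proof -
    have l: "linear (frechet_derivative u (at x))"
      using D by (rule has_derivative_linear)
    have "h = (\<Sum>i\<in>UNIV. h $ i *\<^sub>R axis i 1)"
      by (simp add: vec_eq_iff axis_def if_distrib[of "\<lambda>x. _ * x"] cong: if_cong)
    then have "frechet_derivative u (at x) h = frechet_derivative u (at x) (\<Sum>i\<in>UNIV. h $ i *\<^sub>R axis i 1)"
      by simp
    also have "\<dots> = (\<Sum>i\<in>UNIV. h $ i * frechet_derivative u (at x) (axis i 1))"
      by (simp add: linear_sum[OF l] linear_cmul[OF l])
    finally show ?thesis
      by (simp add: gradient_def inner_vec_def mult.commute)
  qed
  then have "frechet_derivative u (at x) = (\<lambda>h. gradient u x \<bullet> h)"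
    by blast
  with D show ?thesis by simp
qed

lemma has_real_derivative_along_line:
  fixes u :: "real^'n \<Rightarrow> real"
  assumes "u differentiable (at (a + s *\<^sub>R k))"
  shows "((\<lambda>s. u (a + s *\<^sub>R k)) has_real_derivative gradient u (a + s *\<^sub>R k) \<bullet> k) (at s)"
proof -
  have "((\<lambda>s. a + s *\<^sub>R k) has_derivative (\<lambda>s. s *\<^sub>R k)) (at s)"
    by (auto intro!: derivative_eq_intros)
  from has_derivative_compose[OF this has_derivative_gradient[OF assms]]
  have "((\<lambda>s. u (a + s *\<^sub>R k)) has_derivative (\<lambda>r. gradient u (a + s *\<^sub>R k) \<bullet> r *\<^sub>R k)) (at s)" .
  moreover have "(\<lambda>r. gradient u (a + s *\<^sub>R k) \<bullet> r *\<^sub>R k) = (*) (gradient u (a + s *\<^sub>R k) \<bullet> k)"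
    by (simp add: fun_eq_iff)
  ultimately show ?thesis
    by (simp only: has_field_derivative_def)
qed

lemma C2_on_gradient_expansion:
  fixes u :: "real^'n \<Rightarrow> real"
  assumes \<Omega>: "open \<Omega>" "x \<in> \<Omega>" and C2: "C2_on \<Omega> u" and "e > 0"
  obtains d where "d > 0" "\<And>h. norm h \<le> d \<Longrightarrow> x + h \<in> \<Omega>"
    "\<And>h. norm h \<le> d \<Longrightarrow> norm (gradient u (x + h) - gradient u x - hessian u x *v h) \<le> e * norm h"
proof -
  have "(gradient u has_derivative (\<lambda>h. hessian u x *v h)) (at x)"
    using C2 \<Omega> by (simp add: C2_on_def hessian_def jacobian_works)
  then obtain d1 where d1: "d1 > 0"
    "\<And>y. norm (y - x) < d1 \<Longrightarrow>
      norm (gradient u y - gradient u x - hessian u x *v (y - x)) \<le> e * norm (y - x)"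
    using \<open>e > 0\<close> unfolding has_derivative_at_alt by metis
  obtain d2 where d2: "d2 > 0" "ball x d2 \<subseteq> \<Omega>"
    using \<Omega> openE by blast
  show thesis
  \<comment> \<open>Halving the radius passes from strict to non-strict bounds on
    \<open>norm h\<close>, as closed balls require.\<close>
  proof (rule that[of "min d1 d2 / 2"])
    fix h :: "real^'n" assume h: "norm h \<le> min d1 d2 / 2"
    have "x + h \<in> ball x d2"
      using h d1(1) d2(1) by (simp add: dist_norm)
    then show "x + h \<in> \<Omega>"
      using d2 by blast
    show "norm (gradient u (x + h) - gradient u x - hessian u x *v h) \<le> e * norm h"
      using d1(2)[of "x + h"] h d1(1) d2(1) by simp
  qed (use d1 d2 in simp)
qed

text \<open>The mean value theorem along the segment from \<open>x\<close> to \<open>x + h\<close>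
  is applied to \<open>u\<close> minus its quadratic Taylor polynomial. The derivative of this
  difference is the error in the gradient expansion, paired with \<open>h\<close>.\<close>

lemma C2_on_taylor:
  fixes u :: "real^'n \<Rightarrow> real"
  assumes \<Omega>: "open \<Omega>" "x \<in> \<Omega>" and C2: "C2_on \<Omega> u" and "e > 0"
  obtains d where "d > 0" "\<And>h. norm h \<le> d \<Longrightarrow> x + h \<in> \<Omega>"
    "\<And>h. norm h \<le> d \<Longrightarrow>
      \<bar>u (x + h) - u x - gradient u x \<bullet> h - 1 / 2 * (h \<bullet> (hessian u x *v h))\<bar> \<le> e * (norm h)\<^sup>2"
proof -
  obtain d where d: "d > 0" "\<And>h. norm h \<le> d \<Longrightarrow> x + h \<in> \<Omega>"
    "\<And>h. norm h \<le> d \<Longrightarrow> norm (gradient u (x + h) - gradient u x - hessian u x *v h) \<le> e * norm h"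
    using C2_on_gradient_expansion[OF assms] by blast
  show thesis
  proof (rule that[OF d(1,2)])
    fix h :: "real^'n" assume h: "norm h \<le> d"
    let ?q = "h \<bullet> (hessian u x *v h)"
    define f where "f t = u (x + t *\<^sub>R h) - t * (gradient u x \<bullet> h) - t\<^sup>2 / 2 * ?q" for t
    define f' where "f' t = gradient u (x + t *\<^sub>R h) \<bullet> h - gradient u x \<bullet> h - t * ?q" for t
    have small: "norm (t *\<^sub>R h) \<le> norm h" if "0 \<le> t" "t \<le> 1" for t
      using that by (simp add: mult_left_le_one_le)
    have "(f has_real_derivative f' t) (at t)" if "0 \<le> t" "t \<le> 1" for t
    proof -
      have "u differentiable (at (x + t *\<^sub>R h))"
        using C2 d(2)[of "t *\<^sub>R h"] small[OF that] h by (simp add: C2_on_def)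
      from has_real_derivative_along_line[OF this] show ?thesis
        unfolding f_def f'_def by (auto intro!: derivative_eq_intros)
    qed
    then obtain t where t: "0 < t" "t < 1" "f 1 - f 0 = f' t"
      using MVT2[of 0 1 f f'] by auto
    have "f' t = (gradient u (x + t *\<^sub>R h) - gradient u x - hessian u x *v (t *\<^sub>R h)) \<bullet> h"
      by (simp add: f'_def inner_diff_right matrix_vector_mult_scaleR inner_commute[of _ h])
    also have "\<bar>\<dots>\<bar> \<le> norm (gradient u (x + t *\<^sub>R h) - gradient u x - hessian u x *v (t *\<^sub>R h)) * norm h"
      by (rule Cauchy_Schwarz_ineq2)
    also have "\<dots> \<le> (e * norm (t *\<^sub>R h)) * norm h"
      using d(3)[of "t *\<^sub>R h"] small[of t] t h by (intro mult_right_mono) auto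
    also have "\<dots> \<le> (e * norm h) * norm h"
      using small[of t] t \<open>e > 0\<close> by (intro mult_right_mono mult_left_mono) auto
    finally have "\<bar>f 1 - f 0\<bar> \<le> e * (norm h)\<^sup>2"
      by (simp add: t(3) power2_eq_square)
    then show "\<bar>u (x + h) - u x - gradient u x \<bullet> h - 1 / 2 * ?q\<bar> \<le> e * (norm h)\<^sup>2"
      by (simp add: f_def algebra_simps)
  qed
qed

text \<open>The second difference \<open>u (x + th + tk) - u (x + th) - u (x + tk) + u x\<close> is symmetric in \<open>h\<close> and
  \<open>k\<close>, and the mean value theorem in the direction \<open>k\<close> shows that it is \<open>t\<^sup>2 (Hh \<bullet> k) + o(t\<^sup>2)\<close>.\<close>

lemma symmetric_hessian:
  fixes u :: "real^'n \<Rightarrow> real"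
  assumes \<Omega>: "open \<Omega>" "x \<in> \<Omega>" and C2: "C2_on \<Omega> u"
  shows "symmetric_matrix (hessian u x)"
proof -
  let ?H = "hessian u x"
  have eq: "(?H *v h) \<bullet> k = (?H *v k) \<bullet> h" for h k
  proof -
    \<comment> \<open>The summand 1 keeps \<open>N\<close> positive when \<open>h\<close> and
      \<open>k\<close> vanish; with \<open>t = d / N\<close> all points of the second difference
      stay within distance \<open>d\<close> of \<open>x\<close>.\<close>
    define N where "N = norm h + norm k + 1"
    have N: "N > 0" "norm h \<le> N" "norm k \<le> N" "norm h + norm k \<le> N"
      by (simp_all add: N_def add_nonneg_pos)
    have "\<bar>(?H *v h) \<bullet> k - (?H *v k) \<bullet> h\<bar> \<le> 4 * e * N\<^sup>2" if e: "e > 0" for e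
    proof -
      obtain d where d: "d > 0" "\<And>h. norm h \<le> d \<Longrightarrow> x + h \<in> \<Omega>"
        "\<And>h. norm h \<le> d \<Longrightarrow> norm (gradient u (x + h) - gradient u x - ?H *v h) \<le> e * norm h"
        using C2_on_gradient_expansion[OF assms e] by blast
      define t where "t = d / N"
      have t: "t > 0" "t * N = d"
        using d N by (simp_all add: t_def)
      define D where "D = u (x + t *\<^sub>R h + t *\<^sub>R k) - u (x + t *\<^sub>R h) - u (x + t *\<^sub>R k) + u x"
      \<comment> \<open>The directions are left general so that the estimate serves for both orders
        of \<open>h\<close> and \<open>k\<close>. The separate variable \<open>D'\<close> lets the
        same \<open>D\<close> be used in both instances, up to commuting sums.\<close>
      have key: "\<bar>D' - t\<^sup>2 * ((?H *v a) \<bullet> b)\<bar> \<le> 2 * e * t\<^sup>2 * N\<^sup>2"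
        if ab: "norm b \<le> N" "norm a + norm b \<le> N"
          and D': "D' = u (x + t *\<^sub>R a + t *\<^sub>R b) - u (x + t *\<^sub>R a) - u (x + t *\<^sub>R b) + u x" for a b D'
      proof -
        \<comment> \<open>The increment \<open>f t - f 0\<close> is the second difference, so a
          single mean value step in the direction \<open>b\<close> reduces it to a difference of
          gradients.\<close>
        define f where "f s = u (x + t *\<^sub>R a + s *\<^sub>R b) - u (x + s *\<^sub>R b)" for s
        define f' where "f' s = gradient u (x + t *\<^sub>R a + s *\<^sub>R b) \<bullet> b - gradient u (x + s *\<^sub>R b) \<bullet> b" for s
        have small: "norm (t *\<^sub>R a + s *\<^sub>R b) \<le> d" "norm (s *\<^sub>R b) \<le> d" if "0 \<le> s" "s \<le> t" for s
        proof -
          have s1: "norm (s *\<^sub>R b) \<le> t * norm b"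
            using that by (simp add: mult_right_mono)
          have "norm (t *\<^sub>R a + s *\<^sub>R b) \<le> norm (t *\<^sub>R a) + norm (s *\<^sub>R b)"
            by (rule norm_triangle_ineq)
          also have "\<dots> \<le> t * (norm a + norm b)"
            using s1 t by (simp add: distrib_left)
          also have "\<dots> \<le> t * N"
            using ab t by (intro mult_left_mono) auto
          finally show "norm (t *\<^sub>R a + s *\<^sub>R b) \<le> d"
            using t by simp
          have "t * norm b \<le> t * N"
            using ab t by (intro mult_left_mono) auto
          then show "norm (s *\<^sub>R b) \<le> d"
            using s1 t by simp
        qed
        have "(f has_real_derivative f' s) (at s)" if s: "0 \<le> s" "s \<le> t" for s
        proof -
          have "u differentiable (at (x + t *\<^sub>R a + s *\<^sub>R b))" "u differentiable (at (x + s *\<^sub>R b))"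
            using C2 d(2)[OF small(1)[OF s]] d(2)[OF small(2)[OF s]] by (simp_all add: C2_on_def add.assoc)
          from this[THEN has_real_derivative_along_line] show ?thesis
            unfolding f_def f'_def by (auto intro!: derivative_eq_intros)
        qed
        then obtain s where s: "0 < s" "s < t" "f t - f 0 = (t - 0) * f' s"
          using MVT2[of 0 t f f'] t by blast
        let ?r = "\<lambda>h. gradient u (x + h) - gradient u x - ?H *v h"
        have r: "norm (?r z) \<le> e * d" if "norm z \<le> d" for z
        proof -
          have "norm (?r z) \<le> e * norm z"
            by (rule d(3)[OF that])
          also have "\<dots> \<le> e * d"
            using that e by (intro mult_left_mono) auto
          finally show ?thesis .
        qed
        have "f' s - t * ((?H *v a) \<bullet> b) = (?r (t *\<^sub>R a + s *\<^sub>R b) - ?r (s *\<^sub>R b)) \<bullet> b"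
          by (simp add: f'_def inner_diff_left inner_add_left matrix_vector_right_distrib
              matrix_vector_mult_scaleR add.assoc)
        also have "\<bar>\<dots>\<bar> \<le> norm (?r (t *\<^sub>R a + s *\<^sub>R b) - ?r (s *\<^sub>R b)) * norm b"
          by (rule Cauchy_Schwarz_ineq2)
        also have "\<dots> \<le> (e * d + e * d) * N"
        proof (rule mult_mono)
          show "norm (?r (t *\<^sub>R a + s *\<^sub>R b) - ?r (s *\<^sub>R b)) \<le> e * d + e * d"
            using small[of s] s by (intro order_trans[OF norm_triangle_ineq4 add_mono[OF r r]]) auto
        qed (use ab e d(1) in auto)
        finally have "\<bar>f' s - t * ((?H *v a) \<bullet> b)\<bar> \<le> 2 * e * t * N\<^sup>2"
          by (simp add: power2_eq_square mult_ac flip: t(2))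
        then have "t * \<bar>f' s - t * ((?H *v a) \<bullet> b)\<bar> \<le> t * (2 * e * t * N\<^sup>2)"
          using t(1) by (intro mult_left_mono) auto
        moreover have "D' - t\<^sup>2 * ((?H *v a) \<bullet> b) = t * (f' s - t * ((?H *v a) \<bullet> b))"
          using s(3) by (simp add: D' f_def power2_eq_square algebra_simps)
        ultimately show ?thesis
          using t(1) by (simp add: abs_mult power2_eq_square mult_ac)
      qed
      have k1: "\<bar>D - t\<^sup>2 * ((?H *v h) \<bullet> k)\<bar> \<le> 2 * e * t\<^sup>2 * N\<^sup>2"
        by (rule key) (use N in \<open>auto simp: D_def\<close>)
      have k2: "\<bar>D - t\<^sup>2 * ((?H *v k) \<bullet> h)\<bar> \<le> 2 * e * t\<^sup>2 * N\<^sup>2"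
        by (rule key) (use N in \<open>auto simp: D_def ac_simps\<close>)
      have "t\<^sup>2 * \<bar>(?H *v h) \<bullet> k - (?H *v k) \<bullet> h\<bar> = \<bar>t\<^sup>2 * ((?H *v h) \<bullet> k) - t\<^sup>2 * ((?H *v k) \<bullet> h)\<bar>"
        by (simp add: abs_mult flip: right_diff_distrib)
      also have "\<dots> \<le> t\<^sup>2 * (4 * e * N\<^sup>2)"
        using k1 k2 by (simp add: abs_le_iff algebra_simps)
      finally show ?thesis
        using t(1) by simp
    qed
    then have "\<bar>(?H *v h) \<bullet> k - (?H *v k) \<bullet> h\<bar> \<le> 0 + \<delta>" if "\<delta> > 0" for \<delta>
      using that N(1) by (elim meta_allE[of _ "\<delta> / (4 * N\<^sup>2)"]) simp
    then have "\<bar>(?H *v h) \<bullet> k - (?H *v k) \<bullet> h\<bar> \<le> 0"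
      by (rule field_le_epsilon)
    then show ?thesis by simp
  qed
  have "?H $ i $ j = ?H $ j $ i" for i j
    using eq[of "axis j 1" "axis i 1"] by (simp add: inner_axis matrix_vector_mul_component)
  then show ?thesis
    by (simp add: symmetric_matrix_def transpose_def vec_eq_iff)
qed

lemma convex_on_midpoint:
  fixes u :: "'a::real_vector \<Rightarrow> real"
  assumes "convex_on \<Omega> u" "x + h \<in> \<Omega>" "x - h \<in> \<Omega>"
  shows "2 * u x \<le> u (x + h) + u (x - h)"
proof -
  have "(1 - 1 / 2) *\<^sub>R (x + h) + (1 / 2) *\<^sub>R (x - h) = x"
    by (simp add: algebra_simps flip: scaleR_add_left)
  with convex_onD[OF assms(1), of "1 / 2" "x + h" "x - h"] assms(2,3) show ?thesis
    by simp
qed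

text \<open>In the Taylor expansions at \<open>h\<close> and \<open>- h\<close> the gradient terms
  cancel, so the midpoint inequality leaves the Hessian form plus an error. Taking
  \<open>h = t *\<^sub>R v\<close> and dividing by \<open>t\<^sup>2\<close> makes the error
  arbitrarily small.\<close>

lemma positive_semidefinite_hessian:
  fixes u :: "real^'n \<Rightarrow> real"
  assumes \<Omega>: "open \<Omega>" "x \<in> \<Omega>" and C2: "C2_on \<Omega> u" and conv: "convex_on \<Omega> u"
  shows "positive_semidefinite (hessian u x)"
  unfolding positive_semidefinite_def
proof (intro conjI allI symmetric_hessian[OF \<Omega> C2])
  let ?H = "hessian u x"
  fix v :: "real^'n"
  define N where "N = norm v + 1"
  have N: "N > 0" "norm v \<le> N"
    by (simp_all add: N_def add_nonneg_pos)
  have "0 \<le> v \<bullet> (?H *v v) + 2 * e * N\<^sup>2" if e: "e > 0" for e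
  proof -
    obtain d where d: "d > 0" "\<And>h. norm h \<le> d \<Longrightarrow> x + h \<in> \<Omega>"
      "\<And>h. norm h \<le> d \<Longrightarrow>
        \<bar>u (x + h) - u x - gradient u x \<bullet> h - 1 / 2 * (h \<bullet> (?H *v h))\<bar> \<le> e * (norm h)\<^sup>2"
      using C2_on_taylor[OF \<Omega> C2 e] by blast
    define t where "t = d / N"
    have t: "t > 0" "t * N = d"
      using d N by (simp_all add: t_def)
    define h where "h = t *\<^sub>R v"
    have h: "norm h \<le> d"
      using N t by (simp add: h_def mult_left_mono flip: t(2))
    have "2 * u x \<le> u (x + h) + u (x - h)"
      using d(2)[of h] d(2)[of "- h"] h by (intro convex_on_midpoint[OF conv]) simp_all
    moreover have "(- h) \<bullet> (?H *v (- h)) = h \<bullet> (?H *v h)"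
      using matrix_vector_mult_scaleR[of ?H "-1" h] by simp
    ultimately have "0 \<le> h \<bullet> (?H *v h) + 2 * e * (norm h)\<^sup>2"
      using d(3)[of h] d(3)[of "- h"] h by (simp add: abs_le_iff)
    also have "\<dots> \<le> h \<bullet> (?H *v h) + 2 * e * (t * N)\<^sup>2"
      using e h t by (intro add_left_mono mult_left_mono power_mono) auto
    also have "\<dots> = t\<^sup>2 * (v \<bullet> (?H *v v) + 2 * e * N\<^sup>2)"
      by (simp add: h_def matrix_vector_mult_scaleR power2_eq_square algebra_simps)
    finally show ?thesis
      using t(1) by (simp add: zero_le_mult_iff)
  qed
  then have "0 \<le> v \<bullet> (?H *v v) + \<delta>" if "\<delta> > 0" for \<delta>
    using that N(1) by (elim meta_allE[of _ "\<delta> / (2 * N\<^sup>2)"]) simp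
  then show "0 \<le> v \<bullet> (?H *v v)"
    by (rule field_le_epsilon)
qed

section \<open>The asymptotic mean value formula\<close>

text \<open>The linear term has mean zero, and \<open>A\<close> is absorbed into the quadratic form
  by congruence.\<close>

lemma cball_mean_quadratic_polynomial:
  fixes A M :: "real^'n^'n"
  assumes r: "r > 0"
  shows "cball_mean r (\<lambda>y. c + b \<bullet> (A *v y) + k * ((A *v y) \<bullet> (M *v (A *v y))))
    = c + k * (r\<^sup>2 / (real CARD('n) + 2) * trace (transpose A ** M ** A))"
proof -
  have lin: "b \<bullet> (A *v y) = (b v* A) \<bullet> y" for y
    by (simp add: dot_lmul_matrix)
  have quad: "(A *v y) \<bullet> (M *v (A *v y)) = y \<bullet> ((transpose A ** M ** A) *v y)" for y
    using inner_conjugation[of y "transpose A" M] by (simp del: transpose_matrix_vector)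
  have "cball_mean r (\<lambda>y. c + b \<bullet> (A *v y) + k * ((A *v y) \<bullet> (M *v (A *v y))))
    = cball_mean r (\<lambda>y. c + (b v* A) \<bullet> y) + cball_mean r (\<lambda>y. k * (y \<bullet> ((transpose A ** M ** A) *v y)))"
    unfolding lin quad by (rule cball_mean_add) (intro continuous_intros)+
  also have "cball_mean r (\<lambda>y. c + (b v* A) \<bullet> y) = cball_mean r (\<lambda>y::real^'n. c) + cball_mean r (\<lambda>y. (b v* A) \<bullet> y)"
    using cball_mean_add[of r "\<lambda>y. c" "\<lambda>y. (b v* A) \<bullet> y"] by (simp add: continuous_intros)
  finally show ?thesis
    by (simp only: cball_mean_mult_left cball_mean_quadratic_form[OF r] cball_mean_inner
        cball_mean_const[OF r] add_0_right)
qed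

lemma continuous_on_matrix_vector_mult:
  fixes M :: "real^'n^'m"
  assumes "continuous_on S f"
  shows "continuous_on S (\<lambda>y. M *v f y)"
  by (rule continuous_on_compose2[OF matrix_vector_mult_linear_continuous_on assms]) auto

lemma continuous_on_C2_affine:
  fixes A :: "real^'n^'n"
  assumes "C2_on \<Omega> u" "\<And>y. y \<in> S \<Longrightarrow> x + A *v y \<in> \<Omega>"
  shows "continuous_on S (\<lambda>y. u (x + A *v y))"
proof -
  have "continuous_on \<Omega> u"
    using assms(1) by (auto simp: C2_on_def intro!: continuous_at_imp_continuous_on differentiable_imp_continuous_within)
  then show ?thesis
    by (rule continuous_on_compose2) (auto intro!: continuous_intros assms(2))
qed

text \<open>Pairing \<open>y\<close> with \<open>- y\<close> puts the midpoint inequality under the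
  integral.\<close>

lemma ball_average_ge_center:
  fixes A :: "real^'n^'n"
  assumes C2: "C2_on \<Omega> u" and conv: "convex_on \<Omega> u" and r: "r > 0"
    and in\<Omega>: "\<And>y. norm y \<le> r \<Longrightarrow> x + A *v y \<in> \<Omega>"
  shows "u x \<le> ball_average u x A r"
proof -
  let ?f = "\<lambda>y. u (x + A *v y)"
  have cont: "continuous_on (cball 0 r) ?f"
    by (rule continuous_on_C2_affine[OF C2]) (simp add: in\<Omega>)
  then have cont': "continuous_on (cball 0 r) (\<lambda>y. ?f (- y))"
    by (rule continuous_on_compose2) (auto intro!: continuous_intros)
  have "2 * u x = cball_mean r (\<lambda>y::real^'n. 2 * u x)"
    by (simp add: cball_mean_const r)
  also have "\<dots> \<le> cball_mean r (\<lambda>y. ?f y + ?f (- y))"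
  proof (rule cball_mean_mono)
    show "continuous_on (cball 0 r) (\<lambda>y. ?f y + ?f (- y))"
      using cont cont' by (rule continuous_on_add)
    fix y :: "real^'n" assume y: "norm y \<le> r"
    have "A *v (- y) = - (A *v y)"
      using matrix_vector_mult_scaleR[of A "-1" y] by simp
    then show "2 * u x \<le> ?f y + ?f (- y)"
      using convex_on_midpoint[OF conv, of x "A *v y"] in\<Omega>[OF y] in\<Omega>[of "- y"] y by simp
  qed (rule continuous_on_const)
  also have "\<dots> = cball_mean r ?f + cball_mean r ?f"
    by (simp add: cball_mean_add[OF cont cont'] cball_mean_reflect[OF cont])
  finally show ?thesis
    by (simp add: ball_average_eq_cball_mean)
qed

text \<open>The radius \<open>d\<close> is chosen before \<open>r\<close> and \<open>A\<close>, so
  the bound is uniform over matrices that vary with \<open>r\<close>. The loss is a factor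
  \<open>1 - \<eta>\<close> because the Taylor error is compared with the quadratic form
  itself.\<close>

lemma ball_average_lower_bound:
  fixes u :: "real^'n \<Rightarrow> real"
  assumes \<Omega>: "open \<Omega>" "x \<in> \<Omega>" and C2: "C2_on \<Omega> u" and conv: "convex_on \<Omega> u" and \<eta>: "0 < \<eta>" "\<eta> < 1"
  obtains d where "d > 0"
    "\<And>r A. r > 0 \<Longrightarrow> det A = 1 \<Longrightarrow> (\<And>y. norm y \<le> r \<Longrightarrow> norm (A *v y) \<le> d) \<Longrightarrow>
      u x + (1 - \<eta>) * (real CARD('n) / (2 * (real CARD('n) + 2)) * root CARD('n) (det (hessian u x))) * r\<^sup>2
        \<le> ball_average u x A r"
proof (cases "det (hessian u x) = 0")
  case True
  obtain d where "d > 0" "cball x d \<subseteq> \<Omega>"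
    using \<Omega> open_contains_cball by blast
  then have d: "d > 0" "norm h \<le> d \<Longrightarrow> x + h \<in> \<Omega>" for h
    by (auto simp: subset_iff dist_norm)
  show thesis
    by (rule that[OF d(1)]) (simp add: True ball_average_ge_center[OF C2 conv] d(2))
next
  case False
  let ?H = "hessian u x"
  have psd: "positive_semidefinite ?H"
    by (rule positive_semidefinite_hessian[OF \<Omega> C2 conv])
  obtain m where m: "m > 0" "\<And>v. m * (norm v)\<^sup>2 \<le> v \<bullet> (?H *v v)"
    using positive_definite_coercive[OF psd False] by blast
  \<comment> \<open>By coercivity the tolerance \<open>\<eta> * m / 2\<close> amounts to at most the
    fraction \<open>\<eta>\<close> of the quadratic Taylor term.\<close>
  obtain d where d: "d > 0" "\<And>h. norm h \<le> d \<Longrightarrow> x + h \<in> \<Omega>"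
    "\<And>h. norm h \<le> d \<Longrightarrow>
      \<bar>u (x + h) - u x - gradient u x \<bullet> h - 1 / 2 * (h \<bullet> (?H *v h))\<bar> \<le> \<eta> * m / 2 * (norm h)\<^sup>2"
    using C2_on_taylor[OF \<Omega> C2, of "\<eta> * m / 2"] \<eta> m(1) by auto
  have bound: "u x + gradient u x \<bullet> h + (1 - \<eta>) / 2 * (h \<bullet> (?H *v h)) \<le> u (x + h)"
    if "norm h \<le> d" for h
  proof -
    have "\<eta> * m / 2 * (norm h)\<^sup>2 \<le> \<eta> / 2 * (h \<bullet> (?H *v h))"
      using mult_left_mono[OF m(2)[of h], of "\<eta> / 2"] \<eta> by simp
    moreover have "(1 - \<eta>) / 2 * (h \<bullet> (?H *v h)) = 1 / 2 * (h \<bullet> (?H *v h)) - \<eta> / 2 * (h \<bullet> (?H *v h))"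
      by (simp add: left_diff_distrib diff_divide_distrib)
    ultimately show ?thesis
      using d(3)[OF that] unfolding abs_le_iff by linarith
  qed
  show thesis
  proof (rule that[OF d(1)])
    fix r and A :: "real^'n^'n"
    assume r: "r > 0" and det: "det A = 1" and small: "\<And>y. norm y \<le> r \<Longrightarrow> norm (A *v y) \<le> d"
    let ?q = "\<lambda>y. u x + gradient u x \<bullet> (A *v y) + (1 - \<eta>) / 2 * ((A *v y) \<bullet> (?H *v (A *v y)))"
    have "u x + (1 - \<eta>) * (real CARD('n) / (2 * (real CARD('n) + 2)) * root CARD('n) (det ?H)) * r\<^sup>2
      = u x + (1 - \<eta>) / 2 * (r\<^sup>2 / (real CARD('n) + 2) * (real CARD('n) * root CARD('n) (det ?H)))"
      by simp
    also have "\<dots> \<le> u x + (1 - \<eta>) / 2 * (r\<^sup>2 / (real CARD('n) + 2) * trace (transpose A ** ?H ** A))"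
      using trace_congruence_ge[OF psd det] \<eta> by (intro add_left_mono mult_left_mono) auto
    also have "\<dots> = cball_mean r ?q"
      by (rule cball_mean_quadratic_polynomial[OF r, symmetric])
    also have "\<dots> \<le> cball_mean r (\<lambda>y. u (x + A *v y))"
    proof (rule cball_mean_mono)
      show "continuous_on (cball 0 r) (\<lambda>y. u (x + A *v y))"
        by (rule continuous_on_C2_affine[OF C2]) (simp add: d(2) small)
      show "continuous_on (cball 0 r) ?q"
        by (intro continuous_intros continuous_on_matrix_vector_mult)
    qed (rule bound, rule small)
    finally show "u x + (1 - \<eta>) * (real CARD('n) / (2 * (real CARD('n) + 2)) * root CARD('n) (det ?H)) * r\<^sup>2
        \<le> ball_average u x A r"
      by (simp only: ball_average_eq_cball_mean)
  qed
qed

text \<open>The matrix depends on \<open>\<eta>\<close> but not on \<open>r\<close>. Its norm bound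
  \<open>K\<close> is returned as well, since admissibility for small radii follows from it.\<close>

lemma ball_average_upper_bound:
  fixes u :: "real^'n \<Rightarrow> real"
  assumes \<Omega>: "open \<Omega>" "x \<in> \<Omega>" and C2: "C2_on \<Omega> u" and conv: "convex_on \<Omega> u" and \<eta>: "0 < \<eta>"
  obtains A K d where "positive_definite A" "det A = 1" "\<And>v. norm (A *v v) \<le> K * norm v" "d > 0"
    "\<And>r. 0 < r \<Longrightarrow> r \<le> d \<Longrightarrow> ball_average u x A r
      \<le> u x + (real CARD('n) / (2 * (real CARD('n) + 2)) * root CARD('n) (det (hessian u x))) * r\<^sup>2 + \<eta> * r\<^sup>2"
proof -
  let ?H = "hessian u x"
  have psd: "positive_semidefinite ?H"
    by (rule positive_semidefinite_hessian[OF \<Omega> C2 conv])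
  obtain A where A: "positive_definite A" "det A = 1"
    "trace (transpose A ** ?H ** A) < real CARD('n) * root CARD('n) (det ?H) + \<eta>"
    using near_optimal_matrix[OF psd \<eta>] by blast
  obtain K where K: "K > 0" "\<And>v. norm (A *v v) \<le> K * norm v"
    using linear_bounded_pos[of "(*v) A"] by auto
  \<comment> \<open>Since \<open>|Ay| \<le> K * r\<close>, this tolerance costs at most
    \<open>\<eta> / 2 * r\<^sup>2\<close>; the other half of the allowance covers the excess of the
    trace over its lower bound.\<close>
  obtain d where d: "d > 0" "\<And>h. norm h \<le> d \<Longrightarrow> x + h \<in> \<Omega>"
    "\<And>h. norm h \<le> d \<Longrightarrow>
      \<bar>u (x + h) - u x - gradient u x \<bullet> h - 1 / 2 * (h \<bullet> (?H *v h))\<bar> \<le> \<eta> / (2 * K\<^sup>2) * (norm h)\<^sup>2"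
    using C2_on_taylor[OF \<Omega> C2, of "\<eta> / (2 * K\<^sup>2)"] \<eta> K(1) by auto
  show thesis
  proof (rule that[OF A(1,2) K(2)])
    show "d / K > 0"
      using d(1) K(1) by simp
    fix r :: real assume r: "0 < r" "r \<le> d / K"
    have small: "norm (A *v y) \<le> d" "norm (A *v y) \<le> K * r" if "norm y \<le> r" for y
    proof -
      have "norm (A *v y) \<le> K * norm y"
        by (rule K(2))
      also have "\<dots> \<le> K * r"
        using that K(1) by simp
      finally show "norm (A *v y) \<le> K * r" .
      also have "\<dots> \<le> d"
        using r K(1) by (simp add: field_simps)
      finally show "norm (A *v y) \<le> d" .
    qed
    let ?q = "\<lambda>y. (u x + \<eta> / 2 * r\<^sup>2) + gradient u x \<bullet> (A *v y) + 1 / 2 * ((A *v y) \<bullet> (?H *v (A *v y)))"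
    have "ball_average u x A r \<le> cball_mean r ?q"
      unfolding ball_average_eq_cball_mean
    proof (rule cball_mean_mono)
      show "continuous_on (cball 0 r) (\<lambda>y. u (x + A *v y))"
        by (rule continuous_on_C2_affine[OF C2]) (simp add: d(2) small)
      show "continuous_on (cball 0 r) ?q"
        by (intro continuous_intros continuous_on_matrix_vector_mult)
      fix y :: "real^'n" assume y: "norm y \<le> r"
      have "\<eta> / (2 * K\<^sup>2) * (norm (A *v y))\<^sup>2 \<le> \<eta> / (2 * K\<^sup>2) * (K * r)\<^sup>2"
        using small(2)[OF y] \<eta> by (intro mult_left_mono power_mono) auto
      also have "\<dots> = \<eta> / 2 * r\<^sup>2"
        using K(1) by (simp add: power_mult_distrib)
      finally show "u (x + A *v y) \<le> ?q y"
        using d(3)[OF small(1)[OF y]] by (simp add: abs_le_iff algebra_simps)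
    qed
    also have "\<dots> = u x + \<eta> / 2 * r\<^sup>2 + 1 / 2 * (r\<^sup>2 / (real CARD('n) + 2) * trace (transpose A ** ?H ** A))"
      by (rule cball_mean_quadratic_polynomial[OF r(1)])
    also have "\<dots> \<le> u x + \<eta> / 2 * r\<^sup>2
        + 1 / 2 * (r\<^sup>2 / (real CARD('n) + 2) * (real CARD('n) * root CARD('n) (det ?H) + \<eta>))"
      using A(3) by (intro add_left_mono mult_left_mono) auto
    also have "\<dots> = u x + (real CARD('n) / (2 * (real CARD('n) + 2)) * root CARD('n) (det ?H)) * r\<^sup>2
        + (\<eta> / 2 * r\<^sup>2 + \<eta> / 2 * r\<^sup>2 * (1 / (real CARD('n) + 2)))"
    proof -
      have "1 / 2 * (s / D * (k * R + \<eta>)) = (k / (2 * D) * R) * s + \<eta> / 2 * s * (1 / D)" for s D k R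
        by (simp add: distrib_left add_divide_distrib mult_ac)
      from this[of "r\<^sup>2" "real CARD('n) + 2" "real CARD('n)" "root CARD('n) (det ?H)"]
      show ?thesis by linarith
    qed
    also have "\<eta> / 2 * r\<^sup>2 * (1 / (real CARD('n) + 2)) \<le> \<eta> / 2 * r\<^sup>2"
      using \<eta> by (intro mult_left_le) auto
    finally show "ball_average u x A r
      \<le> u x + (real CARD('n) / (2 * (real CARD('n) + 2)) * root CARD('n) (det ?H)) * r\<^sup>2 + \<eta> * r\<^sup>2"
      by simp
  qed
qed

theorem theorem1p1:
  fixes \<Omega> :: "(real ^ 'n::finite) set"
    and \<phi> :: "real \<Rightarrow> real"
    and u :: "real ^ 'n \<Rightarrow> real"
  assumes "open \<Omega>" and "convex \<Omega>"
    and "\<And>\<epsilon>. \<epsilon> > 0 \<Longrightarrow> \<phi> \<epsilon> > 0"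
    and "filterlim \<phi> at_top (at_right 0)"
    and "((\<lambda>\<epsilon>. \<epsilon> * \<phi> \<epsilon>) \<longlongrightarrow> 0) (at_right 0)"
    and "convex_on \<Omega> u"
    and "C2_on \<Omega> u"
  shows "\<forall>x\<in>\<Omega>.
    (\<lambda>\<epsilon>. u x -
       ((INF A\<in>admissible_matrices (\<phi> \<epsilon>). ball_average u x A \<epsilon>)
         - real CARD('n) / (2 * (real CARD('n) + 2))
             * root CARD('n) (det (hessian u x)) * \<epsilon>\<^sup>2))
      \<in> o[at_right 0](\<lambda>\<epsilon>. \<epsilon>\<^sup>2)"
proof (intro ballI landau_o.smallI)
  fix x :: "real^'n" and c :: real
  assume x: "x \<in> \<Omega>" and c: "c > 0"
  define \<kappa> where "\<kappa> = real CARD('n) / (2 * (real CARD('n) + 2)) * root CARD('n) (det (hessian u x))"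
  have "det (hessian u x) \<ge> 0"
    using positive_semidefinite_hessian[OF assms(1) x assms(7,6)] by (rule det_nonneg_positive_semidefinite)
  then have \<kappa>: "\<kappa> \<ge> 0"
    by (simp add: \<kappa>_def)
  \<comment> \<open>This choice gives \<open>\<eta> * \<kappa> \<le> c\<close>, so the
    multiplicative loss in the lower bound costs at most \<open>c * \<epsilon>\<^sup>2\<close>. The
    summand 1 covers \<open>\<kappa> = 0\<close>, and \<open>1 / 2\<close> ensures
    \<open>\<eta> < 1\<close>.\<close>
  define \<eta> where "\<eta> = min (1 / 2) (c / (\<kappa> + 1))"
  have \<eta>: "0 < \<eta>" "\<eta> < 1"
    using c \<kappa> by (auto simp: \<eta>_def add_nonneg_pos)
  have "\<eta> * \<kappa> \<le> c / (\<kappa> + 1) * (\<kappa> + 1)"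
    using \<kappa> c by (intro mult_mono) (auto simp: \<eta>_def)
  then have \<eta>\<kappa>: "\<eta> * \<kappa> \<le> c"
    using \<kappa> by simp
  obtain d where d: "d > 0"
    "\<And>r A. r > 0 \<Longrightarrow> det A = 1 \<Longrightarrow> (\<And>y. norm y \<le> r \<Longrightarrow> norm (A *v y) \<le> d) \<Longrightarrow>
      u x + (1 - \<eta>) * \<kappa> * r\<^sup>2 \<le> ball_average u x A r"
    using ball_average_lower_bound[OF assms(1) x assms(7,6) \<eta>] unfolding \<kappa>_def by blast
  obtain A0 K d' where A0: "positive_definite A0" "det A0 = 1" "\<And>v. norm (A0 *v v) \<le> K * norm v" "d' > 0"
    "\<And>r. 0 < r \<Longrightarrow> r \<le> d' \<Longrightarrow> ball_average u x A0 r \<le> u x + \<kappa> * r\<^sup>2 + c * r\<^sup>2"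
    using ball_average_upper_bound[OF assms(1) x assms(7,6) c] unfolding \<kappa>_def by blast
  \<comment> \<open>The first condition makes \<open>A0\<close> admissible, the second keeps
    \<open>A *v y\<close> within distance \<open>d\<close> of 0 for every admissible
    \<open>A\<close>, and the third is the range of the upper bound.\<close>
  have "\<forall>\<^sub>F \<epsilon> in at_right 0. K \<le> \<phi> \<epsilon>"
    using assms(4) by (simp add: filterlim_at_top)
  moreover have "\<forall>\<^sub>F \<epsilon> in at_right 0. \<epsilon> * \<phi> \<epsilon> < d"
    using order_tendstoD(2)[OF assms(5) d(1)] .
  moreover have "\<forall>\<^sub>F \<epsilon> in at_right 0. 0 < \<epsilon> \<and> \<epsilon> < d'"
    using A0(4) by (auto simp: eventually_at_right)
  ultimately show "\<forall>\<^sub>F \<epsilon> in at_right 0. norm (u x -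
       ((INF A\<in>admissible_matrices (\<phi> \<epsilon>). ball_average u x A \<epsilon>)
         - real CARD('n) / (2 * (real CARD('n) + 2))
             * root CARD('n) (det (hessian u x)) * \<epsilon>\<^sup>2)) \<le> c * norm (\<epsilon>\<^sup>2)"
  proof eventually_elim
    case (elim \<epsilon>)
    let ?S = "admissible_matrices (\<phi> \<epsilon>) :: (real^'n^'n) set"
    let ?I = "INF A\<in>?S. ball_average u x A \<epsilon>"
    have \<epsilon>: "0 < \<epsilon>" "\<epsilon> \<le> d'" and \<phi>: "\<phi> \<epsilon> > 0"
      using elim assms(3) by auto
    have A0S: "A0 \<in> ?S"
    proof (rule admissible_matrices_ge_norm[OF A0(1,2)])
      show "norm (A0 *v v) \<le> \<phi> \<epsilon> * norm v" for v
        using A0(3)[of v] mult_right_mono[OF elim(1), of "norm v"] by simp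
    qed
    have lower: "u x + (1 - \<eta>) * \<kappa> * \<epsilon>\<^sup>2 \<le> ball_average u x A \<epsilon>" if A: "A \<in> ?S" for A
    proof (rule d(2)[OF \<epsilon>(1)])
      show "det A = 1"
        using A by (simp add: admissible_matrices_def)
      fix y :: "real^'n" assume "norm y \<le> \<epsilon>"
      then have "\<phi> \<epsilon> * norm y \<le> \<phi> \<epsilon> * \<epsilon>"
        using \<phi> by simp
      then show "norm (A *v y) \<le> d"
        using admissible_matrices_norm_le[OF A \<phi>, of y] elim(2) by (simp add: mult.commute)
    qed
    \<comment> \<open>A real-valued \<open>INF\<close> is the greatest lower bound only for a
      nonempty family that is bounded below: \<open>A0\<close> shows the former,
      \<open>lower\<close> the latter.\<close>
    have "u x + (1 - \<eta>) * \<kappa> * \<epsilon>\<^sup>2 \<le> ?I"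
      using A0S lower by (intro cINF_greatest) auto
    moreover have "(1 - \<eta>) * \<kappa> * \<epsilon>\<^sup>2 \<ge> \<kappa> * \<epsilon>\<^sup>2 - c * \<epsilon>\<^sup>2"
      using mult_right_mono[OF \<eta>\<kappa>, of "\<epsilon>\<^sup>2"] by (simp add: algebra_simps)
    moreover have "?I \<le> ball_average u x A0 \<epsilon>"
      using A0S lower by (intro cINF_lower bdd_belowI2) auto
    moreover have "ball_average u x A0 \<epsilon> \<le> u x + \<kappa> * \<epsilon>\<^sup>2 + c * \<epsilon>\<^sup>2"
      by (rule A0(5)[OF \<epsilon>])
    ultimately have "\<bar>u x - (?I - \<kappa> * \<epsilon>\<^sup>2)\<bar> \<le> c * \<epsilon>\<^sup>2"
      by linarith
    then show ?case
      by (simp add: \<kappa>_def)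
  qed
qed

end
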